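(* For any $r\in(0,1)$, the Poisson convolution $P_r:H^1\to H^2$ satisfies $$\|P_r\|_{(H^1,H^2)_{cb}}=(1-r^4)^{-1/2}>1 .$$
   Context: $\mathbb{T}$ is the unit circle with normalized Haar measure; $H^p=\{f\in L^p(\mathbb{T}):\widehat f(n)=0\ \forall n<0\}$. $P_r$ is the map $(P_r*h)(e^{i\theta})=\sum_{n\in\mathbb{Z}}r^{|n|}\widehat h(n)e^{in\theta}$. $\|\cdot\|_{(H^1,H^2)_{cb}}$ is the completely bounded norm as a map from $H^1$ to $H^2$. Operator space structures: $L^1(\mathbb{T})$ has its structure as predual of the commutative $C^*$-algebra $L^\infty(\mathbb{T})$, and $H^1$ is viewed as a subspace of it; $L^2(\mathbb{T})=(L^\infty,L^1)_{1/2}$ is Pisier's operator Hilbert space $OH$, and $H^2$ is viewed as a subspace of it. $OH$ is characterized by: for orthonormal vectors $v_i$ and finitely many elements $a_i$ of a $C^*$-algebra $A$, $\|\sum_iv_i\otimes a_i\|_{OH\otimes_{\min}A}=\|\sum_ia_i\otimes\overline a_i\|^{1/2}_{A\otimes_{\min}\overline A}$, where $\overline{A}$ is the complex conjugate $C^*$-algebra. *)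

theory Defs
  imports "HOL-Probability.Probability"
begin

section \<open>Function spaces on the unit circle\<close>

definition circle :: "complex measure" where
  "circle = distr (uniform_measure lborel {0..<2 * pi}) (restrict_space borel (sphere 0 1)) cis"

lemma cis_measurable_circle: "cis \<in> borel \<rightarrow>\<^sub>M restrict_space borel (sphere 0 1)"
  by (intro measurable_restrict_space2 borel_measurable_continuous_onI continuous_intros) auto

lemma prob_space_circle: "prob_space circle"
proof -
  have "prob_space (uniform_measure lborel {0..<2 * pi})"
    by (rule prob_space_uniform_measure) auto
  moreover have "cis \<in> uniform_measure lborel {0..<2 * pi} \<rightarrow>\<^sub>M restrict_space borel (sphere 0 1)"
    using cis_measurable_circle by (simp cong: measurable_cong_sets)
  ultimately show ?thesis
    unfolding circle_def by (rule prob_space.prob_space_distr)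
qed

lemma space_circle [simp]: "space circle = sphere 0 1"
  by (simp add: circle_def space_restrict_space)

text \<open>The spaces below consist of functions, not of classes of functions modulo null functions.
  Accordingly all matrix norms on them are seminorms, which vanish on null functions.\<close>

definition Lp :: "real \<Rightarrow> (complex \<Rightarrow> complex) set" where
  "Lp p = {f \<in> borel_measurable circle. integrable circle (\<lambda>z. cmod (f z) powr p)}"

definition Linfty :: "(complex \<Rightarrow> complex) set" where
  "Linfty = {f \<in> borel_measurable circle. \<exists>C. AE z in circle. cmod (f z) \<le> C}"

definition fourier :: "(complex \<Rightarrow> complex) \<Rightarrow> int \<Rightarrow> complex" where
  "fourier f n = (LINT z|circle. f z * z powi (- n))"

definition Hardy :: "real \<Rightarrow> (complex \<Rightarrow> complex) set" where
  "Hardy p = {f \<in> Lp p. \<forall>n<0. fourier f n = 0}"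

definition poisson :: "real \<Rightarrow> (complex \<Rightarrow> complex) \<Rightarrow> complex \<Rightarrow> complex" where
  "poisson r h z = (\<Sum>\<^sub>\<infinity>n\<in>UNIV. complex_of_real (r ^ nat \<bar>n\<bar>) * fourier h n * z powi n)"


section \<open>Operator spaces\<close>

text \<open>The operator norm on \<open>\<ell>\<^sup>2(I)\<close> of a matrix indexed by a finite set \<open>I\<close>.  With index sets
  such as \<open>{..<m} \<times> {..<n}\<close> it gives the norm of \<open>M\<^sub>m \<otimes> M\<^sub>n = M\<^sub>m(M\<^sub>n)\<close>.\<close>

definition opnorm :: "'i set \<Rightarrow> ('i \<Rightarrow> 'i \<Rightarrow> complex) \<Rightarrow> real" where
  "opnorm I A = (SUP x \<in> {x. L2_set (\<lambda>j. cmod (x j)) I \<le> 1}.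
     L2_set (\<lambda>i. cmod (\<Sum>j\<in>I. A i j * x j)) I)"

text \<open>\<open>matnorm V n\<close> is the norm of \<open>M\<^sub>n(V)\<close>; only the entries \<open>x i j\<close> with \<open>i, j < n\<close> of its
  argument matter.\<close>

record 'a operator_space =
  vecs :: "'a set"
  matnorm :: "nat \<Rightarrow> (nat \<Rightarrow> nat \<Rightarrow> 'a) \<Rightarrow> ereal"

definition mats :: "('a, 'm) operator_space_scheme \<Rightarrow> nat \<Rightarrow> (nat \<Rightarrow> nat \<Rightarrow> 'a) set" where
  "mats V n = {x. \<forall>i<n. \<forall>j<n. x i j \<in> vecs V}"

definition subspace_of :: "'a operator_space \<Rightarrow> 'a set \<Rightarrow> 'a operator_space" where
  "subspace_of V S = V\<lparr>vecs := S\<rparr>"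

definition cb_norm :: "'a operator_space \<Rightarrow> 'b operator_space \<Rightarrow> ('a \<Rightarrow> 'b) \<Rightarrow> ereal" where
  "cb_norm V W u =
    (SUP n\<in>{1..}. SUP x\<in>{x \<in> mats V n. matnorm V n x \<le> 1}. matnorm W n (\<lambda>i j. u (x i j)))"

definition matrix_space :: "nat \<Rightarrow> (nat \<Rightarrow> nat \<Rightarrow> complex) operator_space" where
  "matrix_space n =
    \<lparr>vecs = UNIV,
     matnorm = (\<lambda>m x. ereal (opnorm ({..<m} \<times> {..<n}) (\<lambda>(k, i) (l, j). x k l i j)))\<rparr>"

text \<open>\<open>M\<^sub>m(L\<^sup>\<infinity>) = L\<^sup>\<infinity>(M\<^sub>m)\<close>.\<close>

definition Linfty_space :: "(complex \<Rightarrow> complex) operator_space" where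
  "Linfty_space =
    \<lparr>vecs = Linfty,
     matnorm = (\<lambda>m g. esssup circle (\<lambda>z. ereal (opnorm {..<m} (\<lambda>k l. g k l z))))\<rparr>"

text \<open>\<open>M\<^sub>n(L\<^sup>1)\<close> is normed as a subspace of \<open>M\<^sub>n((L\<^sup>\<infinity>)\<^sup>*) = CB(L\<^sup>\<infinity>, M\<^sub>n)\<close>.\<close>

definition L1_space :: "(complex \<Rightarrow> complex) operator_space" where
  "L1_space =
    \<lparr>vecs = Lp 1,
     matnorm = (\<lambda>n f. cb_norm Linfty_space (matrix_space n) (\<lambda>g i j. LINT z|circle. f i j z * g z))\<rparr>"


subsection \<open>The operator Hilbert space structure on \<open>L\<^sup>2\<close>\<close>

definition L2_inner :: "(complex \<Rightarrow> complex) \<Rightarrow> (complex \<Rightarrow> complex) \<Rightarrow> complex" where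
  "L2_inner f g = (LINT z|circle. f z * cnj (g z))"

definition orthonormal_L2 :: "nat \<Rightarrow> (nat \<Rightarrow> complex \<Rightarrow> complex) \<Rightarrow> bool" where
  "orthonormal_L2 d v \<longleftrightarrow>
    (\<forall>k<d. v k \<in> Lp 2) \<and> (\<forall>k<d. \<forall>l<d. L2_inner (v k) (v l) = (if k = l then 1 else 0))"

text \<open>\<open>OH_expansion n x d v a\<close>: the matrix \<open>x\<close> over \<open>L\<^sup>2\<close> is \<open>\<Sum>\<^sub>k v\<^sub>k \<otimes> a\<^sub>k\<close> with \<open>v\<close> orthonormal and
  \<open>a\<^sub>k \<in> M\<^sub>n\<close>.\<close>

definition OH_expansion ::
  "nat \<Rightarrow> (nat \<Rightarrow> nat \<Rightarrow> complex \<Rightarrow> complex) \<Rightarrow>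
   nat \<Rightarrow> (nat \<Rightarrow> complex \<Rightarrow> complex) \<Rightarrow> (nat \<Rightarrow> nat \<Rightarrow> nat \<Rightarrow> complex) \<Rightarrow> bool" where
  "OH_expansion n x d v a \<longleftrightarrow> orthonormal_L2 d v \<and>
    (\<forall>i<n. \<forall>j<n. AE z in circle. x i j z = (\<Sum>k<d. a k i j * v k z))"

text \<open>\<open>\<parallel>\<Sum>\<^sub>k a\<^sub>k \<otimes> \<bar>a\<^sub>k\<parallel>\<close> to the power \<open>1/2\<close>.  The conjugate algebra of \<open>M\<^sub>n\<close> is identified with \<open>M\<^sub>n\<close> by
  entrywise conjugation, so that \<open>M\<^sub>n \<otimes>\<^sub>m\<^sub>i\<^sub>n \<bar>M\<^sub>n\<close> becomes \<open>M\<^sub>n \<otimes> M\<^sub>n\<close> with the operator norm.\<close>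

definition OH_value :: "nat \<Rightarrow> nat \<Rightarrow> (nat \<Rightarrow> nat \<Rightarrow> nat \<Rightarrow> complex) \<Rightarrow> real" where
  "OH_value n d a =
    sqrt (opnorm ({..<n} \<times> {..<n}) (\<lambda>(i, k) (j, l). \<Sum>s<d. a s i j * cnj (a s k l)))"

text \<open>By the lemmas \<open>OH_expansion_exists\<close> and \<open>OH_matnorm_eq\<close> below, every matrix over \<open>L\<^sup>2\<close> has
  such an expansion, and all of them give the same value.\<close>

definition OH_space :: "(complex \<Rightarrow> complex) operator_space" where
  "OH_space =
    \<lparr>vecs = Lp 2,
     matnorm = (\<lambda>n x. THE c. \<exists>d v a. OH_expansion n x d v a \<and> c = ereal (OH_value n d a))\<rparr>"

definition H1_space :: "(complex \<Rightarrow> complex) operator_space" where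
  "H1_space = subspace_of L1_space (Hardy 1)"

definition H2_space :: "(complex \<Rightarrow> complex) operator_space" where
  "H2_space = subspace_of OH_space (Hardy 2)"


subsection \<open>The \<open>OH\<close> norms are well defined\<close>

lemma Lp_2_iff: "f \<in> Lp 2 \<longleftrightarrow> f \<in> borel_measurable circle \<and> integrable circle (\<lambda>z. (cmod (f z))\<^sup>2)"
  by (auto simp: Lp_def)

lemma Lp_2_measurable [measurable_dest]: "f \<in> Lp 2 \<Longrightarrow> f \<in> borel_measurable circle"
  by (simp add: Lp_2_iff)

lemma integrable_L2_inner:
  assumes f: "f \<in> Lp 2" and g: "g \<in> Lp 2"
  shows "integrable circle (\<lambda>z. f z * cnj (g z))"
proof (rule Bochner_Integration.integrable_bound)
  show "integrable circle (\<lambda>z. (cmod (f z))\<^sup>2 + (cmod (g z))\<^sup>2)"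
    using f g by (simp add: Lp_2_iff)
  have [measurable]: "f \<in> borel_measurable circle" "g \<in> borel_measurable circle"
    using f g by (auto simp: Lp_2_iff)
  have "cnj \<in> borel \<rightarrow>\<^sub>M borel"
    by (intro borel_measurable_continuous_onI continuous_intros)
  from measurable_compose[OF _ this, of g circle]
  show "(\<lambda>z. f z * cnj (g z)) \<in> borel_measurable circle" by measurable
  have "cmod (f z * cnj (g z)) \<le> norm ((cmod (f z))\<^sup>2 + (cmod (g z))\<^sup>2)" for z
  proof -
    have "0 \<le> cmod (f z) * cmod (g z)" by simp
    moreover have "2 * (cmod (f z) * cmod (g z)) \<le> (cmod (f z))\<^sup>2 + (cmod (g z))\<^sup>2"
      using sum_squares_bound[of "cmod (f z)" "cmod (g z)"] by (simp only: mult.assoc)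
    ultimately have "cmod (f z) * cmod (g z) \<le> (cmod (f z))\<^sup>2 + (cmod (g z))\<^sup>2"
      by linarith
    then show ?thesis by (simp only: norm_mult complex_mod_cnj real_norm_def)
  qed
  then show "AE z in circle. cmod (f z * cnj (g z)) \<le> norm ((cmod (f z))\<^sup>2 + (cmod (g z))\<^sup>2)"
    by simp
qed

lemma Lp_2_add: assumes f: "f \<in> Lp 2" and g: "g \<in> Lp 2" shows "(\<lambda>z. f z + g z) \<in> Lp 2"
proof -
  have [measurable]: "f \<in> borel_measurable circle" "g \<in> borel_measurable circle"
    using f g by (auto simp: Lp_2_iff)
  have "integrable circle (\<lambda>z. (cmod (f z + g z))\<^sup>2)"
  proof (rule Bochner_Integration.integrable_bound)
    show "integrable circle (\<lambda>z. 2 * (cmod (f z))\<^sup>2 + 2 * (cmod (g z))\<^sup>2)"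
      using f g by (simp add: Lp_2_iff)
    have "(cmod (f z + g z))\<^sup>2 \<le> 2 * (cmod (f z))\<^sup>2 + 2 * (cmod (g z))\<^sup>2" for z
    proof -
      have "(cmod (f z + g z))\<^sup>2 \<le> (cmod (f z) + cmod (g z))\<^sup>2"
        by (intro power_mono norm_triangle_ineq) auto
      also have "\<dots> \<le> 2 * (cmod (f z))\<^sup>2 + 2 * (cmod (g z))\<^sup>2"
        using sum_squares_bound[of "cmod (f z)" "cmod (g z)"] by (simp add: power2_sum)
      finally show ?thesis .
    qed
    then show "AE z in circle. norm ((cmod (f z + g z))\<^sup>2) \<le>
        norm (2 * (cmod (f z))\<^sup>2 + 2 * (cmod (g z))\<^sup>2)"
      by (auto intro!: AE_I2)
  qed measurable
  then show ?thesis by (simp add: Lp_2_iff)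
qed

lemma Lp_2_scale: "f \<in> Lp 2 \<Longrightarrow> (\<lambda>z. c * f z) \<in> Lp 2"
  by (auto simp: Lp_2_iff norm_mult power_mult_distrib)

lemma Lp_2_sum:
  fixes d :: nat
  shows "(\<And>k. k < d \<Longrightarrow> v k \<in> Lp 2) \<Longrightarrow> (\<lambda>z. \<Sum>k<d. a k * v k z) \<in> Lp 2"
proof (induction d)
  case 0
  then show ?case by (simp add: Lp_2_iff)
next
  case (Suc d)
  then show ?case using Lp_2_add[OF Suc.IH Lp_2_scale[of "v d" "a d"]] by simp
qed

lemma L2_inner_cong:
  assumes "f \<in> Lp 2" "g \<in> Lp 2" "f' \<in> Lp 2" "g' \<in> Lp 2"
    and "AE z in circle. f z = f' z" "AE z in circle. g z = g' z"
  shows "L2_inner f g = L2_inner f' g'"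
  unfolding L2_inner_def
proof (rule integral_cong_AE)
  show "AE z in circle. f z * cnj (g z) = f' z * cnj (g' z)"
    using assms(5,6) by eventually_elim simp
qed (intro borel_measurable_integrable integrable_L2_inner assms)+

lemma L2_inner_sum_left:
  fixes d :: nat
  assumes "\<And>k. k < d \<Longrightarrow> v k \<in> Lp 2" "g \<in> Lp 2"
  shows "L2_inner (\<lambda>z. \<Sum>k<d. a k * v k z) g = (\<Sum>k<d. a k * L2_inner (v k) g)"
proof -
  have "L2_inner (\<lambda>z. \<Sum>k<d. a k * v k z) g
      = (LINT z|circle. (\<Sum>k<d. a k * (v k z * cnj (g z))))"
    unfolding L2_inner_def by (simp add: sum_distrib_right mult.assoc)
  also have "\<dots> = (\<Sum>k<d. LINT z|circle. a k * (v k z * cnj (g z)))"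
    by (rule Bochner_Integration.integral_sum) (use assms integrable_L2_inner in auto)
  finally show ?thesis by (simp add: L2_inner_def)
qed

lemma L2_inner_commute: "L2_inner f g = cnj (L2_inner g f)"
  unfolding L2_inner_def
  by (subst Bochner_Integration.integral_cnj[symmetric]) (simp add: mult.commute)

lemma L2_inner_sum_sum:
  assumes "orthonormal_L2 d v"
  shows "L2_inner (\<lambda>z. \<Sum>k<d. a k * v k z) (\<lambda>z. \<Sum>k<d. b k * v k z) = (\<Sum>k<d. a k * cnj (b k))"
proof -
  have v: "\<And>k. k < d \<Longrightarrow> v k \<in> Lp 2"
    and o: "\<And>k l. k < d \<Longrightarrow> l < d \<Longrightarrow> L2_inner (v k) (v l) = (if k = l then 1 else 0)"
    using assms by (auto simp: orthonormal_L2_def)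
  have "L2_inner (v k) (\<lambda>z. \<Sum>k<d. b k * v k z) = cnj (b k)" if k: "k < d" for k
  proof -
    have "L2_inner (\<lambda>z. \<Sum>l<d. b l * v l z) (v k) = (\<Sum>l<d. b l * L2_inner (v l) (v k))"
      by (rule L2_inner_sum_left) (use v k in auto)
    also have "\<dots> = (\<Sum>l<d. if l = k then b l else 0)"
      by (rule sum.cong) (use o k in auto)
    also have "\<dots> = b k" using k by simp
    finally show ?thesis by (subst L2_inner_commute) simp
  qed
  then show ?thesis
    by (subst L2_inner_sum_left) (auto intro!: v Lp_2_sum)
qed

lemma OH_value_eq_Gram:
  assumes x: "x \<in> mats OH_space n" and e: "OH_expansion n x d v a"
  shows "OH_value n d a =
    sqrt (opnorm ({..<n} \<times> {..<n}) (\<lambda>(i, k) (j, l). L2_inner (x i j) (x k l)))"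
proof -
  have o: "orthonormal_L2 d v"
    and ae: "\<And>i j. i < n \<Longrightarrow> j < n \<Longrightarrow> AE z in circle. x i j z = (\<Sum>k<d. a k i j * v k z)"
    using e by (auto simp: OH_expansion_def)
  have v: "\<And>k. k < d \<Longrightarrow> v k \<in> Lp 2" using o by (auto simp: orthonormal_L2_def)
  have "(\<Sum>s<d. a s i j * cnj (a s k l)) = L2_inner (x i j) (x k l)"
    if "i < n" "j < n" "k < n" "l < n" for i j k l
  proof -
    have "L2_inner (x i j) (x k l)
        = L2_inner (\<lambda>z. \<Sum>s<d. a s i j * v s z) (\<lambda>z. \<Sum>s<d. a s k l * v s z)"
      by (rule L2_inner_cong) (use x that in \<open>auto simp: mats_def OH_space_def intro!: v ae Lp_2_sum\<close>)
    also have "\<dots> = (\<Sum>s<d. a s i j * cnj (a s k l))" by (rule L2_inner_sum_sum[OF o])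
    finally show ?thesis by simp
  qed
  then have "opnorm ({..<n} \<times> {..<n}) (\<lambda>(i, k) (j, l). \<Sum>s<d. a s i j * cnj (a s k l))
      = opnorm ({..<n} \<times> {..<n}) (\<lambda>(i, k) (j, l). L2_inner (x i j) (x k l))"
    unfolding opnorm_def
    by (intro SUP_cong refl L2_set_cong arg_cong[where f = cmod] sum.cong) auto
  then show ?thesis by (simp add: OH_value_def)
qed

lemma OH_matnorm_eq:
  assumes x: "x \<in> mats OH_space n" and e: "OH_expansion n x d v a"
  shows "matnorm OH_space n x = ereal (OH_value n d a)"
proof -
  have "(THE c. \<exists>d v a. OH_expansion n x d v a \<and> c = ereal (OH_value n d a)) = ereal (OH_value n d a)"
  proof (rule the_equality)
    fix c assume "\<exists>d v a. OH_expansion n x d v a \<and> c = ereal (OH_value n d a)"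
    then show "c = ereal (OH_value n d a)" using OH_value_eq_Gram[OF x] e by metis
  qed (use e in blast)
  then show ?thesis by (simp add: OH_space_def)
qed

lemma Gram_Schmidt_L2:
  fixes f :: "nat \<Rightarrow> complex \<Rightarrow> complex"
  assumes "\<And>i. i < N \<Longrightarrow> f i \<in> Lp 2"
  shows "\<exists>d v a. orthonormal_L2 d v \<and>
    (\<forall>i<N. AE z in circle. f i z = (\<Sum>k<d. a k i * v k z))"
  using assms
proof (induction N)
  case 0
  have "orthonormal_L2 0 f" by (simp add: orthonormal_L2_def)
  then show ?case by blast
next
  case (Suc N)
  then obtain d v a where o: "orthonormal_L2 d v"
    and e: "\<And>i. i < N \<Longrightarrow> AE z in circle. f i z = (\<Sum>k<d. a k i * v k z)"
    by (metis less_SucI)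
  have v: "\<And>k. k < d \<Longrightarrow> v k \<in> Lp 2" using o by (auto simp: orthonormal_L2_def)
  have fN: "f N \<in> Lp 2" using Suc.prems by simp
  define b where "b k = L2_inner (f N) (v k)" for k
  define p where "p = (\<lambda>z. \<Sum>k<d. b k * v k z)"
  define g where "g = (\<lambda>z. f N z + (-1) * p z)"
  have p: "p \<in> Lp 2" unfolding p_def by (rule Lp_2_sum) (rule v)
  have g: "g \<in> Lp 2" unfolding g_def by (intro Lp_2_add Lp_2_scale fN p)
  have gv: "L2_inner g (v l) = 0" if l: "l < d" for l
  proof -
    have "L2_inner p (v l) = (\<Sum>k<d. b k * L2_inner (v k) (v l))"
      unfolding p_def by (rule L2_inner_sum_left) (use v l in auto)
    also have "\<dots> = (\<Sum>k<d. if k = l then b k else 0)"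
      by (rule sum.cong) (use o l in \<open>auto simp: orthonormal_L2_def\<close>)
    also have "\<dots> = b l" using l by simp
    finally have "L2_inner p (v l) = b l" .
    moreover have "L2_inner g (v l) = L2_inner (f N) (v l) - L2_inner p (v l)"
      using integrable_L2_inner[OF fN v[OF l]] integrable_L2_inner[OF p v[OF l]]
      by (simp add: L2_inner_def g_def left_diff_distrib)
    ultimately show ?thesis by (simp add: b_def)
  qed
  define q where "q = (LINT z|circle. (cmod (g z))\<^sup>2)"
  have gg: "L2_inner g g = complex_of_real q"
    by (simp add: L2_inner_def q_def complex_norm_square[symmetric] flip: of_real_power)
  have q0: "q \<ge> 0" unfolding q_def by simp
  show ?case
  proof (cases "q = 0")
    case True
    have "AE z in circle. (cmod (g z))\<^sup>2 = 0"
      using True g unfolding q_def by (subst integral_nonneg_eq_0_iff_AE[symmetric]) (auto simp: Lp_2_iff)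
    then have "AE z in circle. f N z = (\<Sum>k<d. b k * v k z)"
      by eventually_elim (simp add: g_def p_def)
    then have "\<forall>i<Suc N. AE z in circle. f i z = (\<Sum>k<d. (if i = N then b k else a k i) * v k z)"
      using e by (auto simp: less_Suc_eq)
    then show ?thesis using o by (intro exI[of _ d] exI[of _ v] exI[of _ "\<lambda>k i. if i = N then b k else a k i"]) auto
  next
    case False
    define w where "w = (\<lambda>z. complex_of_real (1 / sqrt q) * g z)"
    have w: "w \<in> Lp 2" unfolding w_def by (intro Lp_2_scale g)
    have wv: "L2_inner w (v l) = 0" if "l < d" for l
    proof -
      have "L2_inner w (v l) = complex_of_real (1 / sqrt q) * L2_inner g (v l)"
        unfolding L2_inner_def w_def mult.assoc by simp
      then show ?thesis using gv[OF that] by simp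
    qed
    have vw: "L2_inner (v l) w = 0" if "l < d" for l
      using wv[OF that] by (subst L2_inner_commute) simp
    have ww: "L2_inner w w = 1"
    proof -
      have "L2_inner w w = (LINT z|circle. complex_of_real (1 / q) * (g z * cnj (g z)))"
        unfolding L2_inner_def w_def using q0 False
        by (intro Bochner_Integration.integral_cong refl)
          (simp add: field_simps flip: of_real_mult)
      also have "\<dots> = complex_of_real (1 / q) * L2_inner g g"
        by (simp add: L2_inner_def)
      finally show ?thesis using gg False by simp
    qed
    define v' where "v' = v(d := w)"
    define a' where "a' k i = (if i = N then (if k = d then complex_of_real (sqrt q) else b k)
      else if k = d then 0 else a k i)" for k i
    have "orthonormal_L2 (Suc d) v'"
      using o w wv vw ww by (auto simp: orthonormal_L2_def v'_def less_Suc_eq)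
    moreover have "AE z in circle. f i z = (\<Sum>k<Suc d. a' k i * v' k z)" if i: "i < Suc N" for i
    proof (cases "i = N")
      case True
      have "f N z = (\<Sum>k<d. b k * v k z) + complex_of_real (sqrt q) * w z" for z
        using False q0 by (simp add: w_def g_def p_def)
      then have "f i z = (\<Sum>k<Suc d. a' k i * v' k z)" for z
        using True by (simp add: a'_def v'_def)
      then show ?thesis by simp
    next
      case False
      then have "AE z in circle. f i z = (\<Sum>k<d. a k i * v k z)" using e i by simp
      then show ?thesis using False by (simp add: a'_def v'_def)
    qed
    ultimately show ?thesis by blast
  qed
qed

lemma OH_expansion_exists:
  assumes x: "x \<in> mats OH_space n"
  shows "\<exists>d v a. OH_expansion n x d v a"
proof -
  have "x (m div n) (m mod n) \<in> Lp 2" if "m < n * n" for m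
  proof -
    have "n > 0" using that by (cases n) auto
    then have "m div n < n" "m mod n < n"
      using that by (auto simp: less_mult_imp_div_less)
    then show ?thesis using x by (auto simp: mats_def OH_space_def)
  qed
  then obtain d v a where o: "orthonormal_L2 d v"
    and e: "\<forall>m<n * n. AE z in circle. x (m div n) (m mod n) z = (\<Sum>k<d. a k m * v k z)"
    using Gram_Schmidt_L2[of "n * n" "\<lambda>m. x (m div n) (m mod n)"] by blast
  have "AE z in circle. x i j z = (\<Sum>k<d. a k (i * n + j) * v k z)" if "i < n" "j < n" for i j
  proof -
    have "i * n + j < n * n"
    proof -
      have "i * n + j < Suc i * n" using that by simp
      also have "\<dots> \<le> n * n" using that by (intro mult_le_mono1) simp
      finally show ?thesis .
    qed
    moreover have "(i * n + j) div n = i" "(i * n + j) mod n = j" using that by auto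
    ultimately show ?thesis using e by metis
  qed
  then have "OH_expansion n x d v (\<lambda>k i j. a k (i * n + j))"
    using o by (auto simp: OH_expansion_def)
  then show ?thesis by blast
qed

end

theory Submission
  imports Defs
begin

text \<open>
  Put \<open>s = r\<^sup>2\<close>.  If \<open>f\<close> is a matrix over \<open>H\<^sup>1\<close> and \<open>a\<^sub>n\<close> is the matrix of the \<open>n\<close>-th Fourier
  coefficients of its entries, then the square of the \<open>OH\<close> norm of \<open>P\<^sub>r f\<close> is the operator norm of
  \<open>\<Sum>\<^sub>n s\<^sup>n a\<^sub>n \<otimes> \<bar>a\<^sub>n\<close>, which is the Gram matrix of the entries of \<open>P\<^sub>r f\<close>.  The value to be found for
  its supremum, \<open>1 / (1 - s\<^sup>2)\<close>, is the norm of the evaluation functional \<open>h \<mapsto> h(s)\<close> on \<open>H\<^sup>1\<close>, and both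
  bounds come from the two sides of that extremal problem.

  Upper bound.  A matrix \<open>f\<close> in the unit ball is a complete contraction \<open>T\<close> from \<open>L\<^sup>\<infinity>\<close> to \<open>n \<times> n\<close>
  matrices, with \<open>T(z\<^sup>-\<^sup>n) = a\<^sub>n\<close>, so that \<open>T(z\<^sup>k) = 0\<close> for \<open>k > 0\<close>.  Hence \<open>\<Sum>\<^sub>n s\<^sup>n a\<^sub>n \<otimes> \<bar>a\<^sub>n\<close> is the image
  under \<open>T \<otimes> \<bar>T\<close> of every bounded function \<open>\<Phi>\<close> of the quotient of the two variables whose Fourier
  coefficients of index \<open>n \<ge> 0\<close> are \<open>s\<^sup>n\<close>; the negative ones are at our disposal.  The function
  \<open>\<Phi>(\<zeta>) = (1 - s\<^sup>2)\<^sup>-\<^sup>1 (1 - s \<bar>\<zeta>) / (1 - s \<zeta>)\<close>, which represents evaluation at \<open>s\<close> with least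
  supremum norm, has constant modulus \<open>1 / (1 - s\<^sup>2)\<close>.  The tensor product of maps is avoided by
  integrating the variables out one after the other: contractivity of \<open>T\<close> on scalar functions
  (\<open>opnorm_poisson_le\<close>) shows that a matrix of functions is in the unit ball of \<open>L\<^sup>\<infinity>\<close>, and complete
  contractivity is then applied to that matrix (\<open>opnorm_Gram_poisson_le\<close>).

  Lower bound.  The extremal function for evaluation at \<open>s\<close> is a multiple of the square of the
  Szego kernel \<open>\<Sum>\<^sub>i s\<^sup>i z\<^sup>i\<close>.  Its factorisation suggests the Hankel matrix \<open>f\<^sub>i\<^sub>j = z\<^sup>i z\<^sup>j\<close>, a column
  times a row, with \<open>i, j < N\<close>.  By the Cauchy-Schwarz inequality it lies in the unit ball
  (\<open>matnorm_Hankel_le\<close>), and testing the Gram matrix on the vector \<open>\<Sum>\<^sub>j s\<^sup>j e\<^sub>j \<otimes> e\<^sub>j\<close> bounds its norm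
  below by \<open>\<Sum>\<^sub>i\<^sub><\<^sub>N s\<^sup>2\<^sup>i\<close> (\<open>opnorm_Gram_Hankel_ge\<close>).  The bounds meet as \<open>N\<close> grows.
\<close>

section \<open>The operator norm of a finite matrix\<close>

lemma L2_set_apply_le_sum:
  assumes I: "finite I"
  shows "L2_set (\<lambda>i. cmod (\<Sum>j\<in>I. A i j * x j)) I
    \<le> (\<Sum>i\<in>I. \<Sum>j\<in>I. cmod (A i j)) * L2_set (\<lambda>j. cmod (x j)) I"
proof -
  have "L2_set (\<lambda>i. cmod (\<Sum>j\<in>I. A i j * x j)) I \<le> (\<Sum>i\<in>I. cmod (\<Sum>j\<in>I. A i j * x j))"
    by (rule L2_set_le_sum) simp
  also have "\<dots> \<le> (\<Sum>i\<in>I. \<Sum>j\<in>I. cmod (A i j) * L2_set (\<lambda>j. cmod (x j)) I)"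
  proof (rule sum_mono)
    fix i
    have "cmod (\<Sum>j\<in>I. A i j * x j) \<le> (\<Sum>j\<in>I. cmod (A i j) * cmod (x j))"
      by (rule order_trans[OF norm_sum]) (simp add: norm_mult)
    also have "\<dots> \<le> (\<Sum>j\<in>I. cmod (A i j) * L2_set (\<lambda>j. cmod (x j)) I)"
      by (intro sum_mono mult_left_mono member_le_L2_set I) auto
    finally show "cmod (\<Sum>j\<in>I. A i j * x j) \<le> (\<Sum>j\<in>I. cmod (A i j) * L2_set (\<lambda>j. cmod (x j)) I)" .
  qed
  finally show ?thesis by (simp add: sum_distrib_right)
qed

text \<open>Without this the real supremum in \<^const>\<open>opnorm\<close> would be an unspecified value.\<close>
lemma bdd_above_opnorm:
  assumes I: "finite I"
  shows "bdd_above ((\<lambda>x. L2_set (\<lambda>i. cmod (\<Sum>j\<in>I. A i j * x j)) I) `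
    {x. L2_set (\<lambda>j. cmod (x j)) I \<le> 1})"
proof (rule bdd_aboveI2)
  fix x :: "'a \<Rightarrow> complex" assume "x \<in> {x. L2_set (\<lambda>j. cmod (x j)) I \<le> 1}"
  then have "(\<Sum>i\<in>I. \<Sum>j\<in>I. cmod (A i j)) * L2_set (\<lambda>j. cmod (x j)) I
      \<le> (\<Sum>i\<in>I. \<Sum>j\<in>I. cmod (A i j)) * 1"
    by (intro mult_left_mono sum_nonneg) auto
  then show "L2_set (\<lambda>i. cmod (\<Sum>j\<in>I. A i j * x j)) I \<le> (\<Sum>i\<in>I. \<Sum>j\<in>I. cmod (A i j))"
    using L2_set_apply_le_sum[OF I, of A x] by simp
qed

lemma L2_unit_ball_nonempty: "{x :: 'i \<Rightarrow> complex. L2_set (\<lambda>j. cmod (x j)) I \<le> 1} \<noteq> {}"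
proof -
  have "(\<lambda>_. 0 :: complex) \<in> {x :: 'i \<Rightarrow> complex. L2_set (\<lambda>j. cmod (x j)) I \<le> 1}"
    by (simp add: L2_set_def)
  then show ?thesis by (metis empty_iff)
qed

lemma opnorm_le:
  assumes "\<And>x. L2_set (\<lambda>j. cmod (x j)) I \<le> 1 \<Longrightarrow> L2_set (\<lambda>i. cmod (\<Sum>j\<in>I. A i j * x j)) I \<le> c"
  shows "opnorm I A \<le> c"
  unfolding opnorm_def
  by (rule cSUP_least[OF L2_unit_ball_nonempty]) (use assms in simp)

lemma opnorm_bound_unit:
  assumes "finite I" "L2_set (\<lambda>j. cmod (x j)) I \<le> 1"
  shows "L2_set (\<lambda>i. cmod (\<Sum>j\<in>I. A i j * x j)) I \<le> opnorm I A"
  unfolding opnorm_def by (rule cSUP_upper) (use assms bdd_above_opnorm in auto)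

lemma opnorm_bound:
  assumes I: "finite I"
  shows "L2_set (\<lambda>i. cmod (\<Sum>j\<in>I. A i j * x j)) I \<le> opnorm I A * L2_set (\<lambda>j. cmod (x j)) I"
proof (cases "L2_set (\<lambda>j. cmod (x j)) I = 0")
  case True
  then have "\<And>j. j \<in> I \<Longrightarrow> x j = 0" using I by (simp add: L2_set_eq_0_iff)
  then show ?thesis using True by (simp add: L2_set_def)
next
  case False
  define t where "t = L2_set (\<lambda>j. cmod (x j)) I"
  have t: "t > 0" using False by (simp add: t_def order_less_le)
  have *: "L2_set (\<lambda>i. cmod (complex_of_real (1 / t) * y i)) I = L2_set (\<lambda>i. cmod (y i)) I / t" for y
    using L2_set_right_distrib[of "1 / t" "\<lambda>i. cmod (y i)" I] t by (simp add: norm_mult norm_divide)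
  have "L2_set (\<lambda>i. cmod (\<Sum>j\<in>I. A i j * (complex_of_real (1 / t) * x j))) I \<le> opnorm I A"
    by (rule opnorm_bound_unit[OF I]) (unfold *, use t in \<open>simp add: t_def\<close>)
  then have "L2_set (\<lambda>i. cmod (\<Sum>j\<in>I. A i j * x j)) I / t \<le> opnorm I A"
    unfolding mult.left_commute[of _ "complex_of_real (1 / t)"] sum_distrib_left[symmetric] * .
  then show ?thesis using t by (simp add: t_def[symmetric] divide_le_eq)
qed

lemma opnorm_cong:
  assumes "\<And>i j. i \<in> I \<Longrightarrow> j \<in> I \<Longrightarrow> A i j = B i j"
  shows "opnorm I A = opnorm I B"
  unfolding opnorm_def
  by (intro SUP_cong refl L2_set_cong arg_cong[where f = cmod] sum.cong) (use assms in auto)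

lemma opnorm_cnj:
  assumes I: "finite I"
  shows "opnorm I (\<lambda>i j. cnj (A i j)) = opnorm I A"
proof -
  have le: "opnorm I (\<lambda>i j. cnj (A i j)) \<le> opnorm I A" for A
  proof (rule opnorm_le)
    fix x :: "'a \<Rightarrow> complex" assume x: "L2_set (\<lambda>j. cmod (x j)) I \<le> 1"
    have "L2_set (\<lambda>i. cmod (\<Sum>j\<in>I. cnj (A i j) * x j)) I
        = L2_set (\<lambda>i. cmod (cnj (\<Sum>j\<in>I. A i j * cnj (x j)))) I"
      by simp
    also have "\<dots> = L2_set (\<lambda>i. cmod (\<Sum>j\<in>I. A i j * cnj (x j))) I"
      by (simp only: complex_mod_cnj)
    also have "\<dots> \<le> opnorm I A" by (rule opnorm_bound_unit[OF I]) (use x in simp)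
    finally show "L2_set (\<lambda>i. cmod (\<Sum>j\<in>I. cnj (A i j) * x j)) I \<le> opnorm I A" .
  qed
  from le[of A] le[of "\<lambda>i j. cnj (A i j)"] show ?thesis by simp
qed

lemma opnorm_scale_ge:
  fixes c :: real
  assumes I: "finite I" and c: "c > 0"
  shows "c * opnorm I A \<le> opnorm I (\<lambda>i j. complex_of_real c * A i j)"
proof -
  have "opnorm I A \<le> opnorm I (\<lambda>i j. complex_of_real c * A i j) / c"
  proof (rule opnorm_le)
    fix x :: "'a \<Rightarrow> complex" assume x: "L2_set (\<lambda>j. cmod (x j)) I \<le> 1"
    have "c * L2_set (\<lambda>i. cmod (\<Sum>j\<in>I. A i j * x j)) I
        = L2_set (\<lambda>i. c * cmod (\<Sum>j\<in>I. A i j * x j)) I"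
      using c by (simp add: L2_set_right_distrib)
    also have "\<dots> = L2_set (\<lambda>i. cmod (complex_of_real c * (\<Sum>j\<in>I. A i j * x j))) I"
      using c by (simp add: norm_mult)
    also have "\<dots> = L2_set (\<lambda>i. cmod (\<Sum>j\<in>I. complex_of_real c * A i j * x j)) I"
      by (simp add: sum_distrib_left mult.assoc)
    also have "\<dots> \<le> opnorm I (\<lambda>i j. complex_of_real c * A i j)"
      by (rule opnorm_bound_unit[OF I x])
    finally show "L2_set (\<lambda>i. cmod (\<Sum>j\<in>I. A i j * x j)) I
        \<le> opnorm I (\<lambda>i j. complex_of_real c * A i j) / c"
      using c by (simp add: field_simps)
  qed
  then show ?thesis using c by (simp add: field_simps)
qed

text \<open>The half of invariance under relabelling that leads from \<open>M\<^sub>1(M\<^sub>n)\<close> to \<open>M\<^sub>n\<close>.\<close>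
lemma opnorm_reindex_le:
  assumes J: "finite J" and h: "inj_on h J"
  shows "opnorm J (\<lambda>i j. A (h i) (h j)) \<le> opnorm (h ` J) A"
proof (rule opnorm_le)
  fix x :: "'a \<Rightarrow> complex" assume x: "L2_set (\<lambda>j. cmod (x j)) J \<le> 1"
  define y where "y = x \<circ> the_inv_into J h"
  have y: "y (h j) = x j" if "j \<in> J" for j
    using that h by (simp add: y_def the_inv_into_f_f)
  have L2: "L2_set f (h ` J) = L2_set (\<lambda>j. f (h j)) J" for f :: "'b \<Rightarrow> real"
    using h by (simp add: L2_set_def sum.reindex)
  have "L2_set (\<lambda>i. cmod (\<Sum>j\<in>J. A (h i) (h j) * x j)) J
      = L2_set (\<lambda>i. cmod (\<Sum>j\<in>h ` J. A i j * y j)) (h ` J)"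
    using h y by (simp add: L2 sum.reindex)
  also have "\<dots> \<le> opnorm (h ` J) A"
  proof (rule opnorm_bound_unit)
    have "L2_set (\<lambda>j. cmod (y j)) (h ` J) = L2_set (\<lambda>j. cmod (x j)) J"
      unfolding L2 by (intro L2_set_cong) (auto simp: y)
    then show "L2_set (\<lambda>j. cmod (y j)) (h ` J) \<le> 1" using x by simp
  qed (use J in simp)
  finally show "L2_set (\<lambda>i. cmod (\<Sum>j\<in>J. A (h i) (h j) * x j)) J \<le> opnorm (h ` J) A" .
qed

section \<open>Integration over the circle\<close>

lemma sets_circle: "sets circle = sets (restrict_space borel (sphere 0 1))"
  by (simp add: circle_def)

lemma AE_circleI: "(\<And>z. cmod z = 1 \<Longrightarrow> P z) \<Longrightarrow> AE z in circle. P z"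
  by (rule AE_I2) simp

lemma measurable_circle_continuous:
  fixes f :: "complex \<Rightarrow> 'a::topological_space"
  assumes "continuous_on (sphere 0 1) f"
  shows "f \<in> borel_measurable circle"
  using borel_measurable_continuous_on_restrict[OF assms] sets_circle
  by (simp cong: measurable_cong_sets)

text \<open>The operator norm is a supremum of uncountably many functions of \<open>z\<close>, so measurability is not
  automatic; but these functions are continuous, so the supremum is lower semicontinuous.  It is
  needed because \<^const>\<open>esssup\<close> is infinite on non-measurable functions.\<close>
lemma measurable_opnorm:
  assumes I: "finite I" and A: "\<And>i j. i \<in> I \<Longrightarrow> j \<in> I \<Longrightarrow> continuous_on (sphere 0 1) (\<lambda>z. A z i j)"
  shows "(\<lambda>z. opnorm I (A z)) \<in> borel_measurable circle"
  unfolding borel_measurable_iff_greater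
proof
  fix a :: real
  let ?B = "{x :: 'a \<Rightarrow> complex. L2_set (\<lambda>j. cmod (x j)) I \<le> 1}"
  let ?h = "\<lambda>x z. L2_set (\<lambda>i. cmod (\<Sum>j\<in>I. A z i j * x j)) I"
  have "{z \<in> space circle. a < opnorm I (A z)} = (\<Union>x\<in>?B. {z \<in> sphere 0 1. a < ?h x z})"
    unfolding opnorm_def less_cSUP_iff[OF L2_unit_ball_nonempty bdd_above_opnorm[OF I]] by auto
  moreover have "openin (top_of_set (sphere 0 1)) {z \<in> sphere 0 1. a < ?h x z}" for x
  proof -
    have "continuous_on (sphere 0 1) (?h x)"
      unfolding L2_set_def by (intro continuous_intros A)
    from continuous_openin_preimage_gen[OF this, of "{a<..}"]
    show ?thesis by (simp add: vimage_def Int_def conj_commute)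
  qed
  then have "openin (top_of_set (sphere 0 1)) (\<Union>x\<in>?B. {z \<in> sphere 0 1. a < ?h x z})"
    by (intro openin_Union) blast
  ultimately have "openin (top_of_set (sphere 0 1)) {z \<in> space circle. a < opnorm I (A z)}"
    by (simp only:)
  then obtain T where "open T" "{z \<in> space circle. a < opnorm I (A z)} = sphere 0 1 \<inter> T"
    unfolding openin_open by blast
  then show "{z \<in> space circle. a < opnorm I (A z)} \<in> sets circle"
    by (auto simp: sets_circle sets_restrict_space)
qed

interpretation circle: prob_space circle
  by (rule prob_space_circle)

lemma integrable_circle_continuous:
  fixes f :: "complex \<Rightarrow> complex"
  assumes f: "continuous_on (sphere 0 1) f"
  shows "integrable circle f"
proof -
  have "bounded (f ` sphere 0 1)"
    by (intro compact_imp_bounded compact_continuous_image f) simp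
  then obtain B where "\<forall>z\<in>sphere 0 1. cmod (f z) \<le> B"
    unfolding bounded_iff by auto
  then show ?thesis
    by (intro circle.integrable_const_bound[where B = B] AE_circleI measurable_circle_continuous[OF f]) simp
qed

lemma norm_powi_unit: "cmod z = 1 \<Longrightarrow> cmod (z powi k) = 1"
  by (simp add: norm_power_int)

lemma continuous_on_powi_circle: "continuous_on (sphere 0 1) (\<lambda>z::complex. z powi k)"
  by (intro continuous_on_power_int continuous_intros) auto

lemma integral_circle:
  fixes f :: "complex \<Rightarrow> complex"
  assumes "f \<in> borel_measurable circle"
  shows "(LINT z|circle. f z) = (LINT t|lborel. indicator {0..2 * pi} t *\<^sub>R f (cis t)) / (2 * pi)"
proof -
  have f: "f \<in> borel_measurable (restrict_space borel (sphere 0 1))"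
    using assms sets_circle by (simp cong: measurable_cong_sets)
  have fc: "(\<lambda>t. f (cis t)) \<in> borel_measurable borel"
    using measurable_compose[OF cis_measurable_circle f] .
  have "(LINT z|circle. f z) = (LINT t|uniform_measure lborel {0..<2 * pi}. f (cis t))"
    unfolding circle_def
    by (rule integral_distr) (use cis_measurable_circle f in \<open>simp_all cong: measurable_cong_sets\<close>)
  also have "uniform_measure lborel {0..<2 * pi}
      = density lborel (\<lambda>t. ennreal (indicator {0..<2 * pi} t / (2 * pi)))"
    unfolding uniform_measure_def
    by (intro arg_cong2[where f = density] refl ext)
      (auto simp: divide_ennreal ennreal_indicator[symmetric] split: split_indicator)
  also have "(LINT t|\<dots>. f (cis t)) = (LINT t|lborel. (indicator {0..<2 * pi} t / (2 * pi)) *\<^sub>R f (cis t))"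
    by (rule integral_density) (use fc in auto)
  also have "\<dots> = (LINT t|lborel. (indicator {0..2 * pi} t *\<^sub>R f (cis t)) / (2 * pi))"
  proof (rule integral_cong_AE)
    show "AE t in lborel. (indicator {0..<2 * pi} t / (2 * pi)) *\<^sub>R f (cis t)
        = (indicator {0..2 * pi} t *\<^sub>R f (cis t)) / (2 * pi)"
      using AE_lborel_singleton[of "2 * pi"]
      by eventually_elim (auto split: split_indicator simp: scaleR_conv_of_real)
  qed (use fc in measurable)
  finally show ?thesis by simp
qed

lemma integral_powi: "(LINT z|circle. z powi k) = (if k = 0 then 1 else 0)"
proof (cases "k = 0")
  case True
  then show ?thesis using circle.prob_space by simp
next
  case False
  define F where "F t = cis (of_int k * t) / (\<i> * of_int k)" for t :: real
  have "(LINT t|lborel. indicator {0..2 * pi} t *\<^sub>R (cis t powi k)) = F (2 * pi) - F 0"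
  proof (rule integral_FTC_Icc)
    fix t :: real
    show "(F has_vector_derivative cis t powi k) (at t within {0..2 * pi})"
      unfolding F_def has_vector_derivative_def cis_power_int
      using False
      by (auto intro!: derivative_eq_intros simp: scaleR_conv_of_real fun_eq_iff mult.left_commute)
  next
    show "continuous_on {0..2 * pi} (\<lambda>t. cis t powi k)"
      by (intro continuous_on_power_int continuous_intros) auto
  qed simp
  also have "\<dots> = 0" using cis_multiple_2pi[of "of_int k"] by (simp add: F_def mult.commute mult.left_commute)
  finally show ?thesis
    using False by (simp add: integral_circle measurable_circle_continuous continuous_on_powi_circle)
qed

section \<open>Fourier coefficients and the Poisson extension\<close>

lemma Lp_1_iff: "f \<in> Lp 1 \<longleftrightarrow> integrable circle f"
  by (auto simp: Lp_def intro: borel_measurable_integrable integrable_norm_cancel)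

lemma integrable_mult_powi:
  assumes "integrable circle f"
  shows "integrable circle (\<lambda>z. f z * z powi k)"
proof (rule Bochner_Integration.integrable_bound[OF assms])
  have [measurable]: "(\<lambda>z. z powi k) \<in> borel_measurable circle"
    by (rule measurable_circle_continuous[OF continuous_on_powi_circle])
  show "(\<lambda>z. f z * z powi k) \<in> borel_measurable circle" using assms by measurable
  show "AE z in circle. norm (f z * z powi k) \<le> norm (f z)"
    by (rule AE_circleI) (simp add: norm_mult norm_powi_unit)
qed

lemma integral_norm_mult_powi:
  "(LINT z|circle. cmod (f z * z powi k)) = (LINT z|circle. cmod (f z))"
  by (rule Bochner_Integration.integral_cong) (simp_all add: norm_mult norm_powi_unit)

lemma norm_fourier_le: "cmod (fourier f n) \<le> (LINT z|circle. cmod (f z))"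
  unfolding fourier_def using integral_norm_bound[of circle "\<lambda>z. f z * z powi (- n)"]
  by (simp only: integral_norm_mult_powi)

text \<open>The integrals against conjugates of Poisson extensions and against the kernel of the upper bound are
  instances of this termwise integration, dominated by \<open>\<bar>f\<bar> \<Sum>\<^sub>n \<bar>c\<^sub>n\<bar>\<close>.\<close>
lemma integral_mult_power_series:
  assumes f: "integrable circle f" and c: "summable (\<lambda>n. cmod (c n))"
  shows "integrable circle (\<lambda>z. f z * (\<Sum>n. c n * z powi (- int n)))"
    and "(LINT z|circle. f z * (\<Sum>n. c n * z powi (- int n))) = (\<Sum>n. c n * fourier f (int n))"
proof -
  let ?g = "\<lambda>n z. c n * (f z * z powi (- int n))"
  have int: "integrable circle (?g n)" for n
    using integrable_mult_powi[OF f] by simp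
  have sumAE: "AE z in circle. summable (\<lambda>n. norm (?g n z))"
    by (rule AE_circleI) (use c in \<open>simp add: norm_mult norm_powi_unit summable_mult2\<close>)
  have "(LINT z|circle. norm (?g n z)) = cmod (c n) * (LINT z|circle. cmod (f z))" for n
    unfolding norm_mult[of "c n"] by (simp only: integral_norm_mult_powi integral_mult_right_zero)
  then have sumI: "summable (\<lambda>n. LINT z|circle. norm (?g n z))"
    using c by (simp only: summable_mult2)
  have eq: "f z * (\<Sum>n. c n * z powi (- int n)) = (\<Sum>n. ?g n z)" if z: "cmod z = 1" for z
  proof -
    have "summable (\<lambda>n. c n * z powi (- int n))"
      by (rule summable_norm_cancel) (use c z in \<open>simp add: norm_mult norm_powi_unit\<close>)
    from suminf_mult[OF this, of "f z"] show ?thesis by (simp add: mult.left_commute)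
  qed
  have "integrable circle (\<lambda>z. \<Sum>n. ?g n z)"
    by (rule integrable_suminf[OF int sumAE sumI])
  then show "integrable circle (\<lambda>z. f z * (\<Sum>n. c n * z powi (- int n)))"
    by (rule Bochner_Integration.integrable_cong[THEN iffD1, rotated -1]) (simp_all add: eq)
  have "(LINT z|circle. f z * (\<Sum>n. c n * z powi (- int n))) = (LINT z|circle. (\<Sum>n. ?g n z))"
    by (rule Bochner_Integration.integral_cong) (simp_all add: eq)
  also have "\<dots> = (\<Sum>n. LINT z|circle. ?g n z)"
    by (rule integral_suminf[OF int sumAE sumI])
  finally show "(LINT z|circle. f z * (\<Sum>n. c n * z powi (- int n))) = (\<Sum>n. c n * fourier f (int n))"
    by (simp add: fourier_def)
qed

lemma fourier_powi: "fourier (\<lambda>z. z powi m) n = (if n = m then 1 else 0)"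
proof -
  have "fourier (\<lambda>z. z powi m) n = (LINT z|circle. z powi (m - n))"
    unfolding fourier_def
  proof (intro Bochner_Integration.integral_cong refl)
    fix z assume "z \<in> space circle"
    then have "z \<noteq> 0" by auto
    then show "z powi m * z powi (- n) = z powi (m - n)"
      by (simp add: power_int_add[symmetric])
  qed
  then show ?thesis by (simp add: integral_powi)
qed

lemma fourier_power: "fourier (\<lambda>z. z ^ m) (int n) = (if n = m then 1 else 0)"
  using fourier_powi[of "int m" "int n"] by simp

lemma power_in_Hardy: "(\<lambda>z. z ^ k) \<in> Hardy 1"
  using integrable_circle_continuous[OF continuous_on_powi_circle, of "int k"]
    fourier_powi[of "int k"] by (simp add: Hardy_def Lp_1_iff)

lemma cnj_powi_unit: "cmod z = 1 \<Longrightarrow> cnj (z powi k) = z powi (- k)"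
  by (simp add: power_int_minus divide_conv_cnj inverse_eq_divide norm_powi_unit)

lemma summable_poisson_coeffs:
  assumes "0 < r" "r < 1"
  shows "summable (\<lambda>n. cmod (complex_of_real (r ^ n) * fourier h (int n)))"
proof (rule summable_comparison_test')
  show "summable (\<lambda>n. r ^ n * (LINT z|circle. cmod (h z)))"
    using assms by (intro summable_mult2 summable_geometric) simp
  show "norm (cmod (complex_of_real (r ^ n) * fourier h (int n))) \<le> r ^ n * (LINT z|circle. cmod (h z))" for n
    using assms norm_fourier_le[of h "int n"] by (simp add: norm_mult norm_power mult_left_mono)
qed

text \<open>The unordered sum over all integers in \<^const>\<open>poisson\<close> takes the default value 0 if it diverges.
  Here it converges absolutely, since Fourier coefficients are bounded, and the vanishing of the
  negative coefficients turns it into a power series.\<close>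
lemma poisson_sums:
  assumes r: "0 < r" "r < 1" and h: "h \<in> Hardy p" and z: "cmod z \<le> 1"
  shows "(\<lambda>n. complex_of_real (r ^ n) * fourier h (int n) * z ^ n) sums poisson r h z"
proof -
  let ?c = "\<lambda>n. complex_of_real (r ^ n) * fourier h (int n) * z ^ n"
  have sum: "summable (\<lambda>n. cmod (?c n))"
  proof (rule summable_comparison_test'[OF summable_poisson_coeffs[OF r, of h]])
    show "norm (cmod (?c n)) \<le> cmod (complex_of_real (r ^ n) * fourier h (int n))" for n
      using mult_left_mono[OF power_le_one[OF _ z, of n], of "cmod (complex_of_real (r ^ n) * fourier h (int n))"]
      by (simp add: norm_mult norm_power)
  qed
  have "(?c has_sum suminf ?c) UNIV"
    by (rule norm_summable_imp_has_sum[OF sum]) (rule summable_sums[OF summable_norm_cancel[OF sum]])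
  then have "((\<lambda>n. complex_of_real (r ^ nat \<bar>n\<bar>) * fourier h n * z powi n) has_sum suminf ?c) (range int)"
    by (subst has_sum_reindex) (simp_all add: o_def)
  moreover have "fourier h n = 0" if "n \<notin> range int" for n
  proof -
    have "n < 0" using that by (metis int_nat_eq not_le rangeI)
    then show ?thesis using h by (simp add: Hardy_def)
  qed
  ultimately have "((\<lambda>n. complex_of_real (r ^ nat \<bar>n\<bar>) * fourier h n * z powi n) has_sum suminf ?c) UNIV"
    by (subst has_sum_cong_neutral[where T = "range int"]) auto
  then have "poisson r h z = suminf ?c" unfolding poisson_def by (rule infsumI)
  then show ?thesis
    using summable_sums[OF summable_norm_cancel[OF sum]] by simp
qed

lemma continuous_on_poisson:
  assumes r: "0 < r" "r < 1" and h: "h \<in> Hardy p"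
  shows "continuous_on (sphere 0 1) (poisson r h)"
proof -
  have "uniform_limit (sphere 0 1)
      (\<lambda>N z. \<Sum>n<N. complex_of_real (r ^ n) * fourier h (int n) * z ^ n)
      (\<lambda>z. \<Sum>n. complex_of_real (r ^ n) * fourier h (int n) * z ^ n) sequentially"
    by (rule Weierstrass_m_test[OF _ summable_poisson_coeffs[OF r, of h]])
      (simp add: norm_mult norm_power)
  then have "continuous_on (sphere 0 1) (\<lambda>z. \<Sum>n. complex_of_real (r ^ n) * fourier h (int n) * z ^ n)"
    by (rule uniform_limit_theorem[rotated]) (auto intro!: always_eventually continuous_intros)
  then show ?thesis
    by (rule continuous_on_cong[THEN iffD1, rotated 2])
      (use sums_unique[OF poisson_sums[OF r h]] in auto)
qed

text \<open>Parseval's identity for a pair of which only the smoothed member is square integrable.  With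
  smoothing parameter \<open>r\<^sup>2\<close> on one function it computes the same number as smoothing both functions
  by \<open>r\<close>, which is how the Gram matrix of \<open>P\<^sub>r f\<close> becomes an integral against \<open>f\<close> itself.\<close>
lemma integral_mult_cnj_poisson:
  assumes r: "0 < r" "r < 1" and h: "h \<in> Hardy p" and f: "integrable circle f"
  shows "(LINT z|circle. f z * cnj (poisson r h z))
    = (\<Sum>n. complex_of_real (r ^ n) * cnj (fourier h (int n)) * fourier f (int n))"
proof -
  have "cnj (poisson r h z) = (\<Sum>n. complex_of_real (r ^ n) * cnj (fourier h (int n)) * z powi (- int n))"
    if z: "cmod z = 1" for z
  proof -
    have "(\<lambda>n. cnj (complex_of_real (r ^ n) * fourier h (int n) * z ^ n)) sums cnj (poisson r h z)"
      unfolding sums_cnj using poisson_sums[OF r h, of z] z by simp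
    then show ?thesis
      using cnj_powi_unit[OF z, of "int n" for n] by (simp add: sums_iff del: complex_cnj_power of_real_power)
  qed
  then have "(LINT z|circle. f z * cnj (poisson r h z)) = (LINT z|circle. f z *
      (\<Sum>n. complex_of_real (r ^ n) * cnj (fourier h (int n)) * z powi (- int n)))"
    by (intro Bochner_Integration.integral_cong) auto
  also have "\<dots> = (\<Sum>n. complex_of_real (r ^ n) * cnj (fourier h (int n)) * fourier f (int n))"
    by (rule integral_mult_power_series(2)[OF f])
      (use summable_poisson_coeffs[OF r, of h] in \<open>simp add: norm_mult\<close>)
  finally show ?thesis .
qed

lemma fourier_poisson:
  assumes r: "0 < r" "r < 1" and h: "h \<in> Hardy p"
  shows "fourier (poisson r h) k = (if k < 0 then 0 else complex_of_real (r ^ nat k) * fourier h k)"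
proof -
  have "fourier (poisson r h) k = cnj (LINT z|circle. z powi k * cnj (poisson r h z))"
    unfolding fourier_def
    by (subst Bochner_Integration.integral_cnj[symmetric], rule Bochner_Integration.integral_cong)
      (simp_all add: cnj_powi_unit mult.commute del: complex_cnj_power_int)
  also have "(LINT z|circle. z powi k * cnj (poisson r h z))
      = (\<Sum>n. complex_of_real (r ^ n) * cnj (fourier h (int n)) * (if int n = k then 1 else 0))"
    by (subst integral_mult_cnj_poisson[OF r h])
      (simp_all add: fourier_powi integrable_circle_continuous continuous_on_powi_circle)
  also have "\<dots> = (\<Sum>n\<in>{nat k}. complex_of_real (r ^ n) * cnj (fourier h (int n)) * (if int n = k then 1 else 0))"
    by (rule suminf_finite) auto
  finally show ?thesis by auto
qed

lemma Lp_2_continuous: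
  assumes "continuous_on (sphere 0 1) f"
  shows "f \<in> Lp 2"
proof -
  have "integrable circle (\<lambda>z. complex_of_real ((cmod (f z))\<^sup>2))"
    by (intro integrable_circle_continuous continuous_intros assms)
  then show ?thesis
    using measurable_circle_continuous[OF assms] by (simp only: Lp_2_iff complex_of_real_integrable_eq)
qed

lemma poisson_in_Hardy_2:
  assumes "0 < r" "r < 1" and "h \<in> Hardy p"
  shows "poisson r h \<in> Hardy 2"
  using Lp_2_continuous[OF continuous_on_poisson[OF assms]] fourier_poisson[OF assms]
  by (simp add: Hardy_def)

lemma L2_inner_poisson:
  assumes r: "0 < r" "r < 1" and f: "f \<in> Hardy p" and h: "h \<in> Hardy q"
  shows "L2_inner (poisson r f) (poisson r h)
    = (\<Sum>n. complex_of_real ((r\<^sup>2) ^ n) * fourier f (int n) * cnj (fourier h (int n)))"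
  unfolding L2_inner_def
  by (subst integral_mult_cnj_poisson[OF r h integrable_circle_continuous[OF continuous_on_poisson[OF r f]]])
    (simp add: fourier_poisson[OF r f] power2_eq_square power_mult_distrib mult_ac)

section \<open>The upper bound\<close>

lemma continuous_on_circle_Linfty:
  assumes g: "continuous_on (sphere 0 1) g"
  shows "g \<in> Linfty"
proof -
  have "bounded (g ` sphere 0 1)"
    by (intro compact_imp_bounded compact_continuous_image g) simp
  then obtain B where "\<forall>z\<in>sphere 0 1. cmod (g z) \<le> B"
    unfolding bounded_iff by auto
  then have "AE z in circle. cmod (g z) \<le> B" by (intro AE_circleI) simp
  then show ?thesis using measurable_circle_continuous[OF g] by (auto simp: Linfty_def)
qed

text \<open>Complete contractivity of the map attached to \<open>f\<close>, for continuous test matrices.\<close>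
lemma L1_unit_ball_test:
  fixes m :: nat
  assumes f: "matnorm L1_space n f \<le> 1" and m: "m \<ge> 1"
    and cont: "\<And>k l. k < m \<Longrightarrow> l < m \<Longrightarrow> continuous_on (sphere 0 1) (g k l)"
    and norm: "\<And>z. cmod z = 1 \<Longrightarrow> opnorm {..<m} (\<lambda>k l. g k l z) \<le> 1"
  shows "opnorm ({..<m} \<times> {..<n}) (\<lambda>(k, i) (l, j). LINT z|circle. f i j z * g k l z) \<le> 1"
proof -
  have "(\<lambda>z. opnorm {..<m} (\<lambda>k l. g k l z)) \<in> borel_measurable circle"
    by (rule measurable_opnorm) (simp_all add: cont)
  then have "esssup circle (\<lambda>z. ereal (opnorm {..<m} (\<lambda>k l. g k l z))) \<le> 1"
    by (intro esssup_I borel_measurable_ereal AE_circleI) (use norm in simp_all)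
  then have g: "g \<in> {x \<in> mats Linfty_space m. matnorm Linfty_space m x \<le> 1}"
    using cont by (simp add: mats_def Linfty_space_def continuous_on_circle_Linfty)
  have "ereal (opnorm ({..<m} \<times> {..<n}) (\<lambda>(k, i) (l, j). LINT z|circle. f i j z * g k l z))
      = matnorm (matrix_space n) m (\<lambda>k l i j. LINT z|circle. f i j z * g k l z)"
    by (simp add: matrix_space_def)
  also have "\<dots> \<le> matnorm L1_space n f"
    unfolding L1_space_def cb_norm_def operator_space.simps
    by (rule SUP_upper2[of m], use m in simp, rule SUP_upper2[OF g order_refl])
  also have "\<dots> \<le> ereal 1" using f by (simp add: one_ereal_def)
  finally show ?thesis by (simp only: ereal_less_eq)
qed

lemma opnorm_singleton_le: "opnorm {..<1} A \<le> cmod (A (0::nat) 0)"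
proof (rule opnorm_le)
  fix x :: "nat \<Rightarrow> complex" assume "L2_set (\<lambda>j. cmod (x j)) {..<1} \<le> 1"
  then have "cmod (x 0) \<le> 1" by (simp add: L2_set_def)
  then have "cmod (A 0 0) * cmod (x 0) \<le> cmod (A 0 0)"
    by (simp add: mult_left_le)
  then show "L2_set (\<lambda>i. cmod (\<Sum>j\<in>{..<1}. A i j * x j)) {..<1} \<le> cmod (A 0 0)"
    by (simp add: L2_set_def norm_mult)
qed

text \<open>With \<open>\<zeta> = z \<bar>w\<close> this is \<open>(1 - s \<bar>\<zeta>) / (1 - s \<zeta>)\<close>, that is \<open>1 - s\<^sup>2\<close> times the extremal function \<open>\<Phi>\<close>;
  numerator and denominator are conjugate when \<open>z\<close> and \<open>w\<close> lie on the circle.\<close>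
definition unimodular_kernel :: "real \<Rightarrow> complex \<Rightarrow> complex \<Rightarrow> complex" where
  "unimodular_kernel s z w
    = (1 - complex_of_real s * (cnj z * w)) / (1 - complex_of_real s * (z * cnj w))"

lemma unimodular_kernel_denominator:
  assumes "0 < s" "s < 1" "cmod z = 1" "cmod w = 1"
  shows "1 - complex_of_real s * (z * cnj w) \<noteq> 0"
proof
  assume "1 - complex_of_real s * (z * cnj w) = 0"
  then have "cmod (complex_of_real s * (z * cnj w)) = 1" by (metis eq_iff_diff_eq_0 norm_one)
  then show False using assms by (simp add: norm_mult)
qed

lemma norm_unimodular_kernel:
  assumes "0 < s" "s < 1" "cmod z = 1" "cmod w = 1"
  shows "cmod (unimodular_kernel s z w) = 1"
proof -
  have "cmod (1 - complex_of_real s * (cnj z * w)) = cmod (cnj (1 - complex_of_real s * (z * cnj w)))"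
    by simp
  then have "cmod (1 - complex_of_real s * (cnj z * w)) = cmod (1 - complex_of_real s * (z * cnj w))"
    by (simp only: complex_mod_cnj)
  then show ?thesis
    using unimodular_kernel_denominator[OF assms] by (simp add: unimodular_kernel_def norm_divide)
qed

lemma continuous_on_unimodular_kernel:
  assumes "0 < s" "s < 1" "cmod z = 1"
  shows "continuous_on (sphere 0 1) (unimodular_kernel s z)"
  unfolding unimodular_kernel_def
  by (intro continuous_intros) (use unimodular_kernel_denominator[OF assms] in auto)

text \<open>The only term with a positive power of \<open>w\<close> is the last one, and the integral of
  a function in \<open>H\<^sup>1\<close> against it is zero.\<close>
lemma unimodular_kernel_expansion:
  assumes s: "0 < s" "s < 1" and z: "cmod z = 1" and w: "cmod w = 1"
  shows "unimodular_kernel s z w = complex_of_real (1 - s\<^sup>2) *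
      (\<Sum>n. complex_of_real (s ^ n) * z ^ n * w powi (- int n)) - complex_of_real s * cnj z * w"
proof -
  define \<zeta> where "\<zeta> = z * cnj w"
  have "z * cnj z = 1" "w * cnj w = 1"
    using complex_norm_square[of z] complex_norm_square[of w] z w by simp_all
  moreover have "\<zeta> * cnj \<zeta> = (z * cnj z) * (w * cnj w)" by (simp add: \<zeta>_def mult_ac)
  ultimately have \<zeta>: "cnj \<zeta> = cnj z * w" "\<zeta> * cnj \<zeta> = 1" by (simp_all add: \<zeta>_def)
  have "cmod (complex_of_real s * \<zeta>) < 1" using s z w by (simp add: \<zeta>_def norm_mult)
  from suminf_geometric[OF this]
  have "(\<Sum>n. (complex_of_real s * \<zeta>) ^ n) = 1 / (1 - complex_of_real s * \<zeta>)" .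
  moreover have "(complex_of_real s * \<zeta>) ^ n = complex_of_real (s ^ n) * z ^ n * w powi (- int n)" for n
    using cnj_powi_unit[OF w, of "int n"] by (simp add: \<zeta>_def power_mult_distrib)
  ultimately have sum: "(\<Sum>n. complex_of_real (s ^ n) * z ^ n * w powi (- int n))
      = 1 / (1 - complex_of_real s * \<zeta>)"
    by simp
  have ne: "1 - complex_of_real s * \<zeta> \<noteq> 0"
    using unimodular_kernel_denominator[OF s z w] by (simp add: \<zeta>_def)
  \<comment> \<open>Division with remainder by \<open>1 - s \<zeta>\<close>, using \<open>\<zeta> \<bar>\<zeta> = 1\<close>.\<close>
  have "1 - complex_of_real s * cnj \<zeta>
      = complex_of_real (1 - s\<^sup>2) - complex_of_real s * cnj \<zeta> * (1 - complex_of_real s * \<zeta>)"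
    using \<zeta>(2) by (simp add: algebra_simps power2_eq_square)
  then have "(1 - complex_of_real s * cnj \<zeta>) / (1 - complex_of_real s * \<zeta>)
      = (complex_of_real (1 - s\<^sup>2) - complex_of_real s * cnj \<zeta> * (1 - complex_of_real s * \<zeta>))
        / (1 - complex_of_real s * \<zeta>)"
    by (simp only:)
  also have "\<dots> = complex_of_real (1 - s\<^sup>2) * (1 / (1 - complex_of_real s * \<zeta>)) - complex_of_real s * cnj \<zeta>"
    using ne by (simp add: diff_divide_distrib del: of_real_diff)
  finally show ?thesis unfolding sum unimodular_kernel_def by (simp only: \<zeta>_def[symmetric] \<zeta>(1) mult.assoc)
qed

lemma integral_mult_unimodular_kernel:
  assumes s: "0 < s" "s < 1" and h: "h \<in> Hardy 1" and z: "cmod z = 1"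
  shows "(LINT w|circle. h w * unimodular_kernel s z w) = complex_of_real (1 - s\<^sup>2) * poisson s h z"
proof -
  let ?S = "\<lambda>w. \<Sum>n. complex_of_real (s ^ n) * z ^ n * w powi (- int n)"
  have int: "integrable circle h" using h by (simp add: Hardy_def Lp_1_iff)
  have sum: "summable (\<lambda>n. cmod (complex_of_real (s ^ n) * z ^ n))"
    using s z by (simp add: norm_mult norm_power summable_geometric)
  note series = integral_mult_power_series[OF int sum]
  have int1: "integrable circle (\<lambda>w. h w * w)"
    using integrable_mult_powi[OF int, of 1] by simp
  have "(LINT w|circle. h w * unimodular_kernel s z w)
      = (LINT w|circle. complex_of_real (1 - s\<^sup>2) * (h w * ?S w) - (complex_of_real s * cnj z) * (h w * w))"
    by (intro Bochner_Integration.integral_cong refl)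
      (simp add: unimodular_kernel_expansion[OF s z] algebra_simps del: of_real_diff)
  also have "\<dots> = complex_of_real (1 - s\<^sup>2) * (LINT w|circle. h w * ?S w)
      - complex_of_real s * cnj z * (LINT w|circle. h w * w)"
    using series(1) int1 by simp
  also have "(LINT w|circle. h w * w) = fourier h (-1)" by (simp add: fourier_def)
  also have "\<dots> = 0" using h by (simp add: Hardy_def)
  also have "(LINT w|circle. h w * ?S w) = poisson s h z"
    unfolding series(2) using sums_unique[OF poisson_sums[OF s h, of z]] z by (simp add: mult_ac)
  finally show ?thesis by simp
qed

text \<open>First use of the hypothesis on \<open>f\<close>: the map attached to \<open>f\<close> is applied to the scalar function
  \<open>w \<mapsto> unimodular_kernel s z w\<close>, of modulus one, for each fixed \<open>z\<close>.\<close>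
lemma opnorm_poisson_le:
  assumes s: "0 < s" "s < 1" and f: "matnorm L1_space n f \<le> 1"
    and H: "\<And>i j. i < n \<Longrightarrow> j < n \<Longrightarrow> f i j \<in> Hardy 1" and z: "cmod z = 1"
  shows "opnorm {..<n} (\<lambda>i j. complex_of_real (1 - s\<^sup>2) * poisson s (f i j) z) \<le> 1"
proof -
  have "opnorm ({..<1::nat} \<times> {..<n})
      (\<lambda>(k, i) (l, j). LINT w|circle. f i j w * unimodular_kernel s z w) \<le> 1"
  proof (rule L1_unit_ball_test[OF f])
    show "opnorm {..<1::nat} (\<lambda>k l. unimodular_kernel s z w) \<le> 1" if "cmod w = 1" for w
      by (rule order_trans[OF opnorm_singleton_le]) (simp add: norm_unimodular_kernel[OF s z that])
  qed (use continuous_on_unimodular_kernel[OF s z] in auto)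
  moreover have "Pair (0::nat) ` {..<n} = {..<1} \<times> {..<n}" by auto
  ultimately have "opnorm {..<n} (\<lambda>i j. LINT w|circle. f i j w * unimodular_kernel s z w) \<le> 1"
    using opnorm_reindex_le[of "{..<n}" "Pair (0::nat)"
        "\<lambda>(k, i) (l, j). LINT w|circle. f i j w * unimodular_kernel s z w"]
    by (simp add: inj_on_def)
  also have "opnorm {..<n} (\<lambda>i j. LINT w|circle. f i j w * unimodular_kernel s z w)
      = opnorm {..<n} (\<lambda>i j. complex_of_real (1 - s\<^sup>2) * poisson s (f i j) z)"
    by (rule opnorm_cong) (use integral_mult_unimodular_kernel[OF s H z] in auto)
  finally show ?thesis .
qed

text \<open>Second use of the hypothesis on \<open>f\<close>: by the preceding lemma the conjugate of
  \<open>(1 - s\<^sup>2) P\<^sub>s f\<close> is a test matrix of norm at most one, and the map attached to \<open>f\<close> sends it to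
  \<open>1 - s\<^sup>2\<close> times the Gram matrix of \<open>P\<^sub>r f\<close>, up to complex conjugation.\<close>
lemma opnorm_Gram_poisson_le:
  assumes r: "0 < r" "r < 1" and n: "n \<ge> 1" and f: "matnorm L1_space n f \<le> 1"
    and H: "\<And>i j. i < n \<Longrightarrow> j < n \<Longrightarrow> f i j \<in> Hardy 1"
  shows "opnorm ({..<n} \<times> {..<n}) (\<lambda>(i, k) (j, l). L2_inner (poisson r (f i j)) (poisson r (f k l)))
    \<le> 1 / (1 - r ^ 4)"
proof -
  define s where "s = r\<^sup>2"
  have s: "0 < s" "s < 1" using r by (simp_all add: s_def power_less_one_iff)
  have s2: "1 - s\<^sup>2 = 1 - r ^ 4" by (simp add: s_def flip: power_mult)
  have pos: "1 - s\<^sup>2 > 0" using s by (simp add: power_less_one_iff)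
  let ?I = "{..<n} \<times> {..<n}"
  let ?G = "\<lambda>(i, k) (j, l). L2_inner (poisson r (f i j)) (poisson r (f k l))"
  define g where "g k l z = cnj (complex_of_real (1 - s\<^sup>2) * poisson s (f k l) z)" for k l z
  have *: "(LINT z|circle. f i j z * g k l z)
      = complex_of_real (1 - s\<^sup>2) * L2_inner (poisson r (f i j)) (poisson r (f k l))"
    if "i < n" "j < n" "k < n" "l < n" for i j k l
  proof -
    have int: "integrable circle (f i j)" using H[OF that(1,2)] by (simp add: Hardy_def Lp_1_iff)
    have "(LINT z|circle. f i j z * g k l z)
        = (LINT z|circle. complex_of_real (1 - s\<^sup>2) * (f i j z * cnj (poisson s (f k l) z)))"
      by (simp add: g_def mult_ac del: of_real_diff)
    also have "\<dots> = complex_of_real (1 - s\<^sup>2) * (LINT z|circle. f i j z * cnj (poisson s (f k l) z))"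
      by (rule integral_mult_right_zero)
    also have "(LINT z|circle. f i j z * cnj (poisson s (f k l) z))
        = L2_inner (poisson r (f i j)) (poisson r (f k l))"
      by (subst integral_mult_cnj_poisson[OF s H[OF that(3,4)] int])
        (simp add: L2_inner_poisson[OF r H[OF that(1,2)] H[OF that(3,4)]] s_def mult_ac)
    finally show ?thesis .
  qed
  have "opnorm ?I (\<lambda>(k, i) (l, j). LINT z|circle. f i j z * g k l z) \<le> 1"
  proof (rule L1_unit_ball_test[OF f n])
    show "continuous_on (sphere 0 1) (g k l)" if "k < n" "l < n" for k l
      unfolding g_def by (intro continuous_intros continuous_on_poisson[OF s H[OF that]])
    show "opnorm {..<n} (\<lambda>k l. g k l z) \<le> 1" if "cmod z = 1" for z
      unfolding g_def using opnorm_poisson_le[OF s f H that]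
      by (subst opnorm_cnj) auto
  qed
  \<comment> \<open>The factors of the tensor product appear in the opposite order on the two sides; conjugating the
    Gram matrix exchanges them.\<close>
  also have "opnorm ?I (\<lambda>(k, i) (l, j). LINT z|circle. f i j z * g k l z)
      = opnorm ?I (\<lambda>p q. complex_of_real (1 - s\<^sup>2) * cnj (?G p q))"
    by (rule opnorm_cong) (auto simp: * L2_inner_commute[symmetric] simp del: of_real_diff)
  finally have "(1 - s\<^sup>2) * opnorm ?I (\<lambda>p q. cnj (?G p q)) \<le> 1"
    using opnorm_scale_ge[of ?I "1 - s\<^sup>2" "\<lambda>p q. cnj (?G p q)"] pos by simp
  then have "(1 - s\<^sup>2) * opnorm ?I ?G \<le> 1"
    using opnorm_cnj[of ?I ?G] by simp
  then show ?thesis using pos by (simp add: s2 field_simps)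
qed

section \<open>The lower bound\<close>

lemma orthonormal_powers: "orthonormal_L2 N (\<lambda>k z. z ^ k)"
  unfolding orthonormal_L2_def
proof (intro conjI allI impI)
  show "(\<lambda>z. z ^ k) \<in> Lp 2" for k
    by (intro Lp_2_continuous continuous_intros)
  show "L2_inner (\<lambda>z. z ^ k) (\<lambda>z. z ^ l) = (if k = l then 1 else 0)" for k l
  proof -
    have "L2_inner (\<lambda>z. z ^ k) (\<lambda>z. z ^ l) = fourier (\<lambda>z. z powi int k) (int l)"
      unfolding L2_inner_def fourier_def
    proof (rule Bochner_Integration.integral_cong)
      fix z assume "z \<in> space circle"
      then show "z ^ k * cnj (z ^ l) = z powi int k * z powi - int l"
        using cnj_powi_unit[of z "int l"] by simp
    qed simp
    then show ?thesis using fourier_power[of k l] by auto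
  qed
qed

lemma parseval_polynomial:
  "integrable circle (\<lambda>z. (cmod (\<Sum>k<N. c k * z ^ k))\<^sup>2)"
  "(LINT z|circle. (cmod (\<Sum>k<N. c k * z ^ k))\<^sup>2) = (\<Sum>k<N. (cmod (c k))\<^sup>2)"
proof -
  have "(\<lambda>z. \<Sum>k<N. c k * z ^ k) \<in> Lp 2"
    by (intro Lp_2_continuous continuous_intros)
  then show int: "integrable circle (\<lambda>z. (cmod (\<Sum>k<N. c k * z ^ k))\<^sup>2)"
    by (simp add: Lp_2_iff)
  have "complex_of_real (LINT z|circle. (cmod (\<Sum>k<N. c k * z ^ k))\<^sup>2)
      = L2_inner (\<lambda>z. \<Sum>k<N. c k * z ^ k) (\<lambda>z. \<Sum>k<N. c k * z ^ k)"
    unfolding L2_inner_def complex_norm_square[symmetric] by (simp flip: of_real_power)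
  also have "\<dots> = (\<Sum>k<N. c k * cnj (c k))"
    by (rule L2_inner_sum_sum[OF orthonormal_powers])
  also have "\<dots> = complex_of_real (\<Sum>k<N. (cmod (c k))\<^sup>2)"
    by (simp add: complex_norm_square[symmetric] flip: of_real_power)
  finally show "(LINT z|circle. (cmod (\<Sum>k<N. c k * z ^ k))\<^sup>2) = (\<Sum>k<N. (cmod (c k))\<^sup>2)"
    by (simp only: of_real_eq_iff)
qed

lemma integrable_Linfty_mult_continuous:
  assumes g: "g \<in> Linfty" and f: "continuous_on (sphere 0 1) f"
  shows "integrable circle (\<lambda>z. f z * g z)"
proof -
  obtain C where C: "AE z in circle. cmod (g z) \<le> C" and [measurable]: "g \<in> borel_measurable circle"
    using g by (auto simp: Linfty_def)
  have [measurable]: "f \<in> borel_measurable circle" by (rule measurable_circle_continuous[OF f])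
  show ?thesis
  proof (rule Bochner_Integration.integrable_bound)
    show "integrable circle (\<lambda>z. complex_of_real C * f z)"
      using integrable_circle_continuous[OF f] by simp
    show "AE z in circle. cmod (f z * g z) \<le> cmod (complex_of_real C * f z)"
      using C
    proof eventually_elim
      case (elim z)
      then have "cmod (f z) * cmod (g z) \<le> cmod (f z) * \<bar>C\<bar>" by (intro mult_left_mono) auto
      then show ?case by (simp add: norm_mult mult.commute)
    qed
  qed measurable
qed

text \<open>Cauchy-Schwarz in the linearised form \<open>\<alpha>\<beta> \<le> (\<alpha>\<^sup>2 + \<beta>\<^sup>2) / 2\<close>, which can be integrated term by
  term.\<close>
lemma sum_product_le_half_squares:
  assumes I: "finite I"
  shows "cmod (\<Sum>k\<in>I. y k * (\<Sum>l\<in>I. A k l * x l))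
    \<le> opnorm I A * (((\<Sum>k\<in>I. (cmod (y k))\<^sup>2) + (\<Sum>l\<in>I. (cmod (x l))\<^sup>2)) / 2)"
proof -
  let ?a = "L2_set (\<lambda>k. cmod (y k)) I" and ?b = "L2_set (\<lambda>l. cmod (x l)) I"
  have nn: "opnorm I A \<ge> 0"
    using opnorm_bound_unit[OF I, of "\<lambda>_. 0" A] by (simp add: L2_set_def)
  have "cmod (\<Sum>k\<in>I. y k * (\<Sum>l\<in>I. A k l * x l))
      \<le> (\<Sum>k\<in>I. \<bar>cmod (y k)\<bar> * \<bar>cmod (\<Sum>l\<in>I. A k l * x l)\<bar>)"
    by (rule order_trans[OF norm_sum]) (simp add: norm_mult)
  also have "\<dots> \<le> ?a * L2_set (\<lambda>k. cmod (\<Sum>l\<in>I. A k l * x l)) I"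
    by (rule L2_set_mult_ineq)
  also have "\<dots> \<le> ?a * (opnorm I A * ?b)"
    by (intro mult_left_mono opnorm_bound I) simp
  also have "\<dots> = opnorm I A * (?a * ?b)" by simp
  also have "\<dots> \<le> opnorm I A * ((?a\<^sup>2 + ?b\<^sup>2) / 2)"
    by (intro mult_left_mono nn) (use sum_squares_bound[of ?a ?b] in simp)
  also have "?a\<^sup>2 = (\<Sum>k\<in>I. (cmod (y k))\<^sup>2)" by (simp add: L2_set_def sum_nonneg)
  also have "?b\<^sup>2 = (\<Sum>l\<in>I. (cmod (x l))\<^sup>2)" by (simp add: L2_set_def sum_nonneg)
  finally show ?thesis .
qed

text \<open>Because \<open>z\<^sup>i\<^sup>+\<^sup>j = z\<^sup>i z\<^sup>j\<close>, the sesquilinear form of this matrix at \<open>\<xi>\<close>, \<open>\<eta>\<close> is the integral of the form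
  of \<open>g(z)\<close> at vector-valued polynomials \<open>X(z)\<close>, \<open>Y(z)\<close> with coefficients \<open>\<xi>\<close> and \<open>\<bar>\<eta>\<close>, whose mean
  square norms are those of \<open>\<xi>\<close> and \<open>\<eta>\<close>.  Taking for \<open>\<eta>\<close> the image of \<open>\<xi>\<close> and writing \<open>S\<close>, \<open>T\<close> for
  the squared norms of \<open>\<eta>\<close>, \<open>\<xi>\<close> gives \<open>S \<le> (S + T) / 2\<close>, hence \<open>S \<le> T\<close>.\<close>
lemma opnorm_Hankel_le:
  fixes m :: nat
  assumes g: "\<And>k l. k < m \<Longrightarrow> l < m \<Longrightarrow> g k l \<in> Linfty"
    and norm: "AE z in circle. opnorm {..<m} (\<lambda>k l. g k l z) \<le> 1"
  shows "opnorm ({..<m} \<times> {..<N}) (\<lambda>(k, i) (l, j). LINT z|circle. z ^ (i + j) * g k l z) \<le> 1"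
    (is "opnorm ?I ?A \<le> 1")
proof (rule opnorm_le)
  fix \<xi> :: "nat \<times> nat \<Rightarrow> complex" assume \<xi>: "L2_set (\<lambda>p. cmod (\<xi> p)) ?I \<le> 1"
  define \<eta> where "\<eta> p = (\<Sum>q\<in>?I. ?A p q * \<xi> q)" for p
  define X where "X l z = (\<Sum>j<N. \<xi> (l, j) * z ^ j)" for l z
  define Y where "Y k z = (\<Sum>i<N. cnj (\<eta> (k, i)) * z ^ i)" for k z
  define G where "G z = (\<Sum>k<m. Y k z * (\<Sum>l<m. g k l z * X l z))" for z
  define S where "S = (\<Sum>p\<in>?I. (cmod (\<eta> p))\<^sup>2)"
  define T where "T = (\<Sum>p\<in>?I. (cmod (\<xi> p))\<^sup>2)"
  have T: "T \<le> 1" using \<xi> by (simp add: T_def L2_set_def)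
  have int: "integrable circle (\<lambda>z. z ^ (i + j) * g k l z)" if "k < m" "l < m" for i j k l
    by (intro integrable_Linfty_mult_continuous g that continuous_intros)
  have G_eq: "G z = (\<Sum>k<m. \<Sum>i<N. \<Sum>l<m. \<Sum>j<N.
      cnj (\<eta> (k, i)) * \<xi> (l, j) * (z ^ (i + j) * g k l z))" for z
  proof -
    have "G z = (\<Sum>k<m. \<Sum>i<N. cnj (\<eta> (k, i)) * z ^ i * (\<Sum>l<m. g k l z * X l z))"
      by (simp only: G_def Y_def sum_distrib_right)
    then show ?thesis by (simp add: X_def sum_distrib_left power_add mult_ac)
  qed
  have G_integral: "has_bochner_integral circle G (\<Sum>k<m. \<Sum>i<N. \<Sum>l<m. \<Sum>j<N.
      cnj (\<eta> (k, i)) * \<xi> (l, j) * (LINT z|circle. z ^ (i + j) * g k l z))"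
    unfolding G_eq[abs_def]
    by (intro has_bochner_integral_sum has_bochner_integral_mult_right has_bochner_integral_integrable int)
      auto
  have "complex_of_real S = (\<Sum>p\<in>?I. cnj (\<eta> p) * \<eta> p)"
    unfolding S_def by (simp add: complex_norm_square[symmetric] mult.commute flip: of_real_power)
  also have "\<dots> = (\<Sum>k<m. \<Sum>i<N. cnj (\<eta> (k, i)) * (\<Sum>l<m. \<Sum>j<N. ?A (k, i) (l, j) * \<xi> (l, j)))"
    by (simp add: sum.cartesian_product' \<eta>_def)
  also have "\<dots> = (\<Sum>k<m. \<Sum>i<N. \<Sum>l<m. \<Sum>j<N.
      cnj (\<eta> (k, i)) * \<xi> (l, j) * (LINT z|circle. z ^ (i + j) * g k l z))"
    by (simp add: sum_distrib_left mult.assoc mult.left_commute[of _ "\<xi> _"] mult.commute[of _ "\<xi> _"])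
  also have "\<dots> = (LINT z|circle. G z)"
    by (rule has_bochner_integral_integral_eq[OF G_integral, symmetric])
  finally have SG: "complex_of_real S = (LINT z|circle. G z)" .
  have "S \<ge> 0" by (simp add: S_def sum_nonneg)
  then have "S = cmod (complex_of_real S)" by simp
  also have "\<dots> \<le> (LINT z|circle. cmod (G z))" unfolding SG by (rule integral_norm_bound)
  also have "\<dots> \<le> (LINT z|circle. ((\<Sum>k<m. (cmod (Y k z))\<^sup>2) + (\<Sum>l<m. (cmod (X l z))\<^sup>2)) / 2)"
  proof (rule integral_mono_AE)
    show "integrable circle (\<lambda>z. cmod (G z))" using G_integral by (auto intro: integrable.intros)
    show "integrable circle (\<lambda>z. ((\<Sum>k<m. (cmod (Y k z))\<^sup>2) + (\<Sum>l<m. (cmod (X l z))\<^sup>2)) / 2)"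
      unfolding X_def Y_def by (simp add: parseval_polynomial)
    show "AE z in circle. cmod (G z) \<le> ((\<Sum>k<m. (cmod (Y k z))\<^sup>2) + (\<Sum>l<m. (cmod (X l z))\<^sup>2)) / 2"
      using norm
    proof eventually_elim
      case (elim z)
      then have "opnorm {..<m} (\<lambda>k l. g k l z) * (((\<Sum>k<m. (cmod (Y k z))\<^sup>2) + (\<Sum>l<m. (cmod (X l z))\<^sup>2)) / 2)
          \<le> 1 * (((\<Sum>k<m. (cmod (Y k z))\<^sup>2) + (\<Sum>l<m. (cmod (X l z))\<^sup>2)) / 2)"
        by (intro mult_right_mono) (auto intro!: add_nonneg_nonneg sum_nonneg)
      then show ?case
        using sum_product_le_half_squares[of "{..<m}" "\<lambda>k. Y k z" "\<lambda>k l. g k l z" "\<lambda>l. X l z"]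
        by (simp add: G_def)
    qed
  qed
  also have "\<dots> = (S + T) / 2"
    unfolding X_def Y_def S_def T_def
    by (simp add: parseval_polynomial sum.cartesian_product')
  finally have "S \<le> 1" using T by simp
  then show "L2_set (\<lambda>p. cmod (\<Sum>q\<in>?I. ?A p q * \<xi> q)) ?I \<le> 1"
    by (simp add: L2_set_def S_def \<eta>_def)
qed

lemma matnorm_Hankel_le: "matnorm L1_space N (\<lambda>i j z. z ^ (i + j)) \<le> 1"
  unfolding L1_space_def cb_norm_def operator_space.simps
proof (intro SUP_least)
  fix m g assume "g \<in> {x \<in> mats Linfty_space m. matnorm Linfty_space m x \<le> 1}"
  then have g: "\<And>k l. k < m \<Longrightarrow> l < m \<Longrightarrow> g k l \<in> Linfty"
    and norm: "esssup circle (\<lambda>z. ereal (opnorm {..<m} (\<lambda>k l. g k l z))) \<le> 1"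
    by (auto simp: mats_def Linfty_space_def)
  have "AE z in circle. opnorm {..<m} (\<lambda>k l. g k l z) \<le> 1"
    using esssup_AE[of "\<lambda>z. ereal (opnorm {..<m} (\<lambda>k l. g k l z))" circle]
  proof eventually_elim
    case (elim z)
    then have "ereal (opnorm {..<m} (\<lambda>k l. g k l z)) \<le> 1" using norm by (rule order_trans)
    then show ?case by simp
  qed
  from opnorm_Hankel_le[OF g this]
  show "matnorm (matrix_space N) m (\<lambda>k l i j. LINT z|circle. z ^ (i + j) * g k l z) \<le> 1"
    by (simp add: matrix_space_def)
qed

text \<open>The Gram matrix has the entry \<open>s\<^sup>i\<^sup>+\<^sup>j\<close> where \<open>i + j = k + l\<close> and \<open>0\<close> elsewhere.  The vector
  \<open>\<Sum>\<^sub>j s\<^sup>j e\<^sub>j \<otimes> e\<^sub>j\<close> is an eigenvector, since on its support \<open>j = l\<close> the condition reduces to \<open>i = k\<close>.\<close>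
lemma opnorm_Gram_Hankel_ge:
  assumes r: "0 < r" "r < 1"
  shows "(\<Sum>i<N. (r ^ 4) ^ i) \<le> opnorm ({..<N} \<times> {..<N})
    (\<lambda>(i, k) (j, l). L2_inner (poisson r (\<lambda>z. z ^ (i + j))) (poisson r (\<lambda>z. z ^ (k + l))))"
    (is "?q \<le> opnorm ?I ?G")
proof (cases "N = 0")
  case True
  then show ?thesis
    using opnorm_bound_unit[of ?I "\<lambda>_. 0" ?G] by (simp add: L2_set_def)
next
  case False
  define s where "s = r\<^sup>2"
  have s: "0 < s" using r by (simp add: s_def)
  define \<xi> where "\<xi> = (\<lambda>(j, l). if j = l then complex_of_real (s ^ j) else 0 :: complex)"
  have s4: "s ^ i * s ^ i = (r ^ 4) ^ i" for i
    by (simp add: s_def flip: power_mult power_add)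
  have q: "?q > 0" using False r by (intro sum_pos) auto
  have G: "L2_inner (poisson r (\<lambda>z. z ^ (i + j))) (poisson r (\<lambda>z. z ^ (k + l)))
      = (if i + j = k + l then complex_of_real (s ^ (i + j)) else 0)" for i j k l
  proof -
    have "L2_inner (poisson r (\<lambda>z. z ^ (i + j))) (poisson r (\<lambda>z. z ^ (k + l))) = (\<Sum>n. complex_of_real (s ^ n) * (if n = i + j then 1 else 0) *
        cnj (if n = k + l then 1 else 0))"
      by (simp add: L2_inner_poisson[OF r power_in_Hardy power_in_Hardy] fourier_power s_def)
    also have "\<dots> = (\<Sum>n\<in>{i + j}. complex_of_real (s ^ n) * (if n = i + j then 1 else 0) *
        cnj (if n = k + l then 1 else 0))"
      by (rule suminf_finite) auto
    finally show ?thesis by simp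
  qed
  have diag: "L2_set (\<lambda>p. cmod (complex_of_real c * \<xi> p)) ?I = \<bar>c\<bar> * sqrt ?q" for c
  proof -
    have "(\<Sum>p\<in>?I. (cmod (\<xi> p))\<^sup>2) = (\<Sum>j<N. \<Sum>l<N. if j = l then s ^ j * s ^ j else 0)"
      unfolding sum.cartesian_product'[symmetric] sum.cartesian_product
      by (intro sum.cong) (use s in \<open>auto simp: \<xi>_def power2_eq_square norm_power\<close>)
    also have "\<dots> = ?q" by (simp add: s4)
    finally have "L2_set (\<lambda>p. cmod (\<xi> p)) ?I = sqrt ?q" by (simp add: L2_set_def)
    then show ?thesis
      using L2_set_right_distrib[of "\<bar>c\<bar>" "\<lambda>p. cmod (\<xi> p)" ?I] by (simp add: norm_mult)
  qed
  have "(\<Sum>p\<in>?I. ?G (i, k) p * \<xi> p) = complex_of_real ?q * \<xi> (i, k)" if "k < N" for i k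
  proof -
    have "(\<Sum>p\<in>?I. ?G (i, k) p * \<xi> p)
        = (\<Sum>j<N. \<Sum>l<N. if j = l then (if i = k then complex_of_real (s ^ (i + j) * s ^ j) else 0) else 0)"
      unfolding sum.cartesian_product
      by (intro sum.cong refl) (auto simp: G \<xi>_def)
    also have "\<dots> = (\<Sum>j<N. if i = k then complex_of_real (s ^ (i + j) * s ^ j) else 0)" by simp
    also have "\<dots> = (if i = k then complex_of_real (s ^ i * (\<Sum>j<N. s ^ j * s ^ j)) else 0)"
      by (simp add: power_add sum_distrib_left mult_ac)
    also have "\<dots> = complex_of_real ?q * \<xi> (i, k)" by (simp add: s4 \<xi>_def)
    finally show ?thesis .
  qed
  then have "L2_set (\<lambda>p. cmod (\<Sum>q\<in>?I. ?G p q * \<xi> q)) ?I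
      = L2_set (\<lambda>p. cmod (complex_of_real ?q * \<xi> p)) ?I"
    by (intro L2_set_cong refl arg_cong[where f = cmod]) auto
  then have "?q * sqrt ?q \<le> opnorm ?I ?G * sqrt ?q"
    using opnorm_bound[of ?I ?G \<xi>] diag[of ?q] diag[of 1] q by simp
  then show ?thesis using q by simp
qed

section \<open>The completely bounded norm\<close>

lemma matnorm_H2_poisson:
  assumes r: "0 < r" "r < 1" and f: "f \<in> mats H1_space n"
  shows "matnorm H2_space n (\<lambda>i j. poisson r (f i j)) = ereal (sqrt (opnorm ({..<n} \<times> {..<n})
    (\<lambda>(i, k) (j, l). L2_inner (poisson r (f i j)) (poisson r (f k l)))))"
proof -
  have x: "(\<lambda>i j. poisson r (f i j)) \<in> mats OH_space n"
    using f Lp_2_continuous[OF continuous_on_poisson[OF r]]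
    by (auto simp: mats_def OH_space_def H1_space_def subspace_of_def)
  obtain d v a where e: "OH_expansion n (\<lambda>i j. poisson r (f i j)) d v a"
    using OH_expansion_exists[OF x] by blast
  show ?thesis
    using OH_matnorm_eq[OF x e] OH_value_eq_Gram[OF x e]
    by (simp add: H2_space_def subspace_of_def)
qed

theorem corollary6p17:
  fixes r :: real
  assumes "0 < r" and "r < 1"
  shows "(\<forall>h\<in>Hardy 1. poisson r h \<in> Hardy 2) \<and>
    cb_norm H1_space H2_space (poisson r) = ereal ((1 - r ^ 4) powr (- (1 / 2))) \<and>
    (1 - r ^ 4) powr (- (1 / 2)) > 1"
proof (intro conjI ballI)
  note r = assms
  have r4: "0 < r ^ 4" "r ^ 4 < 1" using r by (simp_all add: power_less_one_iff)
  have powr: "(1 - r ^ 4) powr (- (1 / 2)) = sqrt (1 / (1 - r ^ 4))"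
    using r4 by (simp add: powr_minus powr_half_sqrt real_sqrt_divide inverse_eq_divide)
  show "poisson r h \<in> Hardy 2" if "h \<in> Hardy 1" for h
    using poisson_in_Hardy_2[OF r that] .
  show "(1 - r ^ 4) powr (- (1 / 2)) > 1" unfolding powr using r4 by simp
  show "cb_norm H1_space H2_space (poisson r) = ereal ((1 - r ^ 4) powr (- (1 / 2)))"
    unfolding powr
  proof (rule antisym)
    show "cb_norm H1_space H2_space (poisson r) \<le> ereal (sqrt (1 / (1 - r ^ 4)))"
      unfolding cb_norm_def
    proof (intro SUP_least)
      fix n f assume n: "n \<in> {1..}" and f: "f \<in> {x \<in> mats H1_space n. matnorm H1_space n x \<le> 1}"
      then have "matnorm L1_space n f \<le> 1" "\<And>i j. i < n \<Longrightarrow> j < n \<Longrightarrow> f i j \<in> Hardy 1"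
        by (auto simp: mats_def H1_space_def subspace_of_def)
      from opnorm_Gram_poisson_le[OF r _ this] n
      show "matnorm H2_space n (\<lambda>i j. poisson r (f i j)) \<le> ereal (sqrt (1 / (1 - r ^ 4)))"
        using f by (subst matnorm_H2_poisson[OF r]) simp_all
    qed
    have "(\<lambda>N. \<Sum>i<N. (r ^ 4) ^ i) \<longlonglongrightarrow> 1 / (1 - r ^ 4)"
      using geometric_sums[of "r ^ 4"] r4 by (simp add: sums_def)
    then have "(\<lambda>N. ereal (sqrt (\<Sum>i<N. (r ^ 4) ^ i))) \<longlonglongrightarrow> ereal (sqrt (1 / (1 - r ^ 4)))"
      by (intro tendsto_ereal tendsto_real_sqrt)
    then show "ereal (sqrt (1 / (1 - r ^ 4))) \<le> cb_norm H1_space H2_space (poisson r)"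
    proof (rule Lim_bounded[where M = 1], intro allI impI)
      fix N :: nat assume N: "N \<ge> 1"
      let ?x = "\<lambda>i j z. z ^ (i + j) :: complex"
      have x: "?x \<in> mats H1_space N"
        using power_in_Hardy by (simp add: mats_def H1_space_def subspace_of_def)
      have "?x \<in> {x \<in> mats H1_space N. matnorm H1_space N x \<le> 1}"
        using x matnorm_Hankel_le[of N] by (simp add: H1_space_def subspace_of_def)
      then have "matnorm H2_space N (\<lambda>i j. poisson r (?x i j)) \<le> cb_norm H1_space H2_space (poisson r)"
        unfolding cb_norm_def using N by (intro SUP_upper2[of N] SUP_upper2[of ?x]) auto
      moreover have "ereal (sqrt (\<Sum>i<N. (r ^ 4) ^ i)) \<le> matnorm H2_space N (\<lambda>i j. poisson r (?x i j))"
        using opnorm_Gram_Hankel_ge[OF r, of N] by (simp add: matnorm_H2_poisson[OF r x])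
      ultimately show "ereal (sqrt (\<Sum>i<N. (r ^ 4) ^ i)) \<le> cb_norm H1_space H2_space (poisson r)"
        by (rule order_trans[rotated])
    qed
  qed
qed

end
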